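(* The positive cone of $\mathcal B_T^r(H)$ is exactly the cone of order-positive $T$-strongly bounded operators: $$\bigl(\mathcal B_T^r(H)\bigr)_+=\mathcal B_T(H)_+.$$ Moreover, $\mathcal B_T^r(H)$ is an order ideal of $\mathcal L_b^A(H)$; equivalently, if $R\in\mathcal L_b^A(H)$ and $S\in\mathcal B_T^r(H)$ satisfy $|R|_{\rm ord}\le|S|_{\rm ord}$, then $R\in\mathcal B_T^r(H)$.
   Context: Setting. All spaces are real. $E$ is a Dedekind complete Riesz space with weak order unit $e$. $T:E\to E$ is a conditional expectation operator, i.e. a positive order-continuous linear projection whose range is a Dedekind complete Riesz subspace and which maps weak order units to weak order units; it satisfies $Te=e$ and is strictly positive ($x\ge 0$ and $Tx=0$ imply $x=0$). $E^u$ is the universal completion of $E$, with its $f$-algebra multiplication having unit $e$. $L^1(T)\subseteq E^u$ is the natural domain of $T$: the set of differences $f_1-f_2$ with $f_i\in E^u_+$ such that there is a net $(f_\alpha)$ in $E_+$ with $f_\alpha\uparrow f_i$ in $E^u$ and $(Tf_\alpha)$ bounded above in $E^u$; $T$ is extended to $L^1(T)$ by $Tf_i=\sup_\alpha Tf_\alpha$, and the extension, still denoted $T$, is again a strictly positive conditional expectation on $L^1(T)$ with $Te=e$. $A:=R(T)$ is the range of the (extended) $T$; it is a Dedekind complete unital Archimedean $f$-algebra with unit $e$, and $T(az)=aT(z)$ for $a\in A$ whenever the products are defined. $H:=L^2(T)=\{x\in L^1(T):x^2\in L^1(T)\}$ with the inherited order is a Dedekind complete Riesz space and an $A$-module. For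 $x,y\in H$, $\langle x,y\rangle_T:=T(xy)\in A$ and $\|x\|_{T,2}:=(T(x^2))^{1/2}\in A_+$ (the positive square root in $A$). Definitions. $\mathcal B_T(H)$ is the set of $A$-linear (additive and $A$-homogeneous) maps $S:H\to H$ that are $T$-strongly bounded: there is $k\in A_+$ with $\|Sx\|_{T,2}\le k\|x\|_{T,2}$ for all $x\in H$. An operator $S$ on $H$ is order positive if $x\ge0$ implies $Sx\ge0$; $R\le Q$ means that $Q-R$ is order positive. $\mathcal B_T(H)_+$ is the set of order-positive operators in $\mathcal B_T(H)$, and $\mathcal B_T^r(H):=\mathcal B_T(H)_+-\mathcal B_T(H)_+$ (the $T$-regular operators), a vector lattice for the order inherited from $\mathcal L_b^A(H)$. $\mathcal L_b^A(H)$ is the set of $A$-linear order-bounded operators $R:H\to H$; with the order in which $R\le Q$ means that $Q-R$ is order positive, it is a Dedekind complete vector lattice whose modulus is the Riesz--Kantorovich one: $|R|_{\rm ord}x=\sup\{|Ru|:|u|\le x\}$ for $x\in H_+$. *)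

theory Defs
  imports
    Complex_Main
    "HOL-Library.Lattice_Algebras"
    "HOL-Library.Lub_Glb"
begin

text \<open>
  The universal completion \<open>E\<^sup>u\<close> is a type \<open>'u\<close> of sort
  \<open>{ordered_real_vector, real_algebra, lattice_ring}\<close>: a real Riesz space with a compatible ring
  multiplication, where \<open>\<bar>x\<bar> = sup x (- x)\<close>.  The space \<open>E\<close> is a subset of \<open>'u\<close>.  A multiplicative
  unit is deliberately not part of the sort, since class \<open>ring_1\<close> would exclude the zero space.

  Suprema relative to a set \<open>S\<close> are expressed by \<open>isLub S D s\<close>: the element \<open>s\<close> is the least of
  the upper bounds of \<open>D\<close> that lie in \<open>S\<close>.
\<close>

section \<open>Riesz spaces\<close>

definition riesz_subspace :: "'u::{ordered_real_vector, lattice} set \<Rightarrow> bool" where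
  "riesz_subspace S \<longleftrightarrow>
     subspace S \<and> (\<forall>x\<in>S. \<forall>y\<in>S. sup x y \<in> S \<and> inf x y \<in> S)"

definition dedekind_complete :: "'u::order set \<Rightarrow> bool" where
  "dedekind_complete S \<longleftrightarrow>
     (\<forall>D. D \<subseteq> S \<and> D \<noteq> {} \<and> (\<exists>b. isUb S D b) \<longrightarrow> (\<exists>s. isLub S D s))"

definition laterally_complete :: "'u::{ordered_real_vector, lattice} set \<Rightarrow> bool" where
  "laterally_complete S \<longleftrightarrow>
     (\<forall>D. D \<subseteq> S \<and> D \<noteq> {} \<and> (\<forall>d\<in>D. 0 \<le> d) \<and> (\<forall>d\<in>D. \<forall>d'\<in>D. d \<noteq> d' \<longrightarrow> inf d d' = 0)
        \<longrightarrow> (\<exists>s. isLub S D s))"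

definition order_dense :: "'u::{ordered_real_vector, lattice} set \<Rightarrow> bool" where
  "order_dense S \<longleftrightarrow> (\<forall>x. 0 < x \<longrightarrow> (\<exists>y\<in>S. 0 < y \<and> y \<le> x))"

text \<open>The universal completion of \<open>E\<close> is determined, up to a Riesz isomorphism fixing \<open>E\<close>, as the
  universally complete Riesz space containing \<open>E\<close> as an order dense Riesz subspace.\<close>

definition is_universal_completion ::
    "'u::{ordered_real_vector, lattice} set \<Rightarrow> bool" where
  "is_universal_completion E \<longleftrightarrow>
     riesz_subspace E \<and> order_dense E \<and>
     dedekind_complete (UNIV :: 'u set) \<and> laterally_complete (UNIV :: 'u set)"

definition weak_order_unit ::
    "'u::{ordered_real_vector, lattice_ab_group_add_abs} set \<Rightarrow> 'u \<Rightarrow> bool" where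
  "weak_order_unit S w \<longleftrightarrow> w \<in> S \<and> 0 \<le> w \<and> (\<forall>x\<in>S. inf w \<bar>x\<bar> = 0 \<longrightarrow> x = 0)"

definition f_algebra_with_unit ::
    "'u::{ordered_real_vector, real_algebra, lattice_ring} \<Rightarrow> bool" where
  "f_algebra_with_unit e \<longleftrightarrow>
     (\<forall>x y z :: 'u. inf x y = 0 \<and> 0 \<le> z \<longrightarrow> inf (z * x) y = 0 \<and> inf (x * z) y = 0) \<and>
     (\<forall>x. e * x = x \<and> x * e = x)"

section \<open>Conditional expectation operators\<close>

text \<open>Monotone nets are represented by their ranges.  An increasing net in \<open>E\<close> has an upward
  directed range with the same supremum, and each upward directed set is the range of the increasing
  net indexed by itself; an increasing map takes the net to one whose range is the image set.\<close>

definition up_directed :: "'u::order set \<Rightarrow> bool" where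
  "up_directed D \<longleftrightarrow> D \<noteq> {} \<and> (\<forall>x\<in>D. \<forall>y\<in>D. \<exists>z\<in>D. x \<le> z \<and> y \<le> z)"

definition down_directed :: "'u::order set \<Rightarrow> bool" where
  "down_directed D \<longleftrightarrow> D \<noteq> {} \<and> (\<forall>x\<in>D. \<forall>y\<in>D. \<exists>z\<in>D. z \<le> x \<and> z \<le> y)"

text \<open>\<open>T\<close> is a map on the whole type, but only its restriction to \<open>E\<close> is relevant.\<close>

definition conditional_expectation ::
    "'u::{ordered_real_vector, lattice_ab_group_add_abs} set \<Rightarrow> ('u \<Rightarrow> 'u) \<Rightarrow> bool" where
  "conditional_expectation E T \<longleftrightarrow>
     T ` E \<subseteq> E \<and>
     (\<forall>x\<in>E. \<forall>y\<in>E. T (x + y) = T x + T y) \<and>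
     (\<forall>c. \<forall>x\<in>E. T (c *\<^sub>R x) = c *\<^sub>R T x) \<and>
     (\<forall>x\<in>E. 0 \<le> x \<longrightarrow> 0 \<le> T x) \<and>
     (\<forall>D. D \<subseteq> E \<and> down_directed D \<and> isGlb E D 0 \<longrightarrow> isGlb E (T ` D) 0) \<and>
     (\<forall>x\<in>E. T (T x) = T x) \<and>
     riesz_subspace (T ` E) \<and> dedekind_complete (T ` E) \<and>
     (\<forall>w. weak_order_unit E w \<longrightarrow> weak_order_unit E (T w))"

definition strictly_positive ::
    "'u::ordered_real_vector set \<Rightarrow> ('u \<Rightarrow> 'u) \<Rightarrow> bool" where
  "strictly_positive E T \<longleftrightarrow> (\<forall>x\<in>E. 0 \<le> x \<and> T x = 0 \<longrightarrow> x = 0)"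

section \<open>The natural domain and the extended operator\<close>

definition increases_to ::
    "'u::{ordered_real_vector, lattice} set \<Rightarrow> 'u set \<Rightarrow> 'u \<Rightarrow> bool" where
  "increases_to E D f \<longleftrightarrow> D \<subseteq> E \<and> (\<forall>d\<in>D. 0 \<le> d) \<and> up_directed D \<and> isLub UNIV D f"

definition natural_cone ::
    "'u::{ordered_real_vector, lattice} set \<Rightarrow> ('u \<Rightarrow> 'u) \<Rightarrow> 'u set" where
  "natural_cone E T = {f. 0 \<le> f \<and> (\<exists>D. increases_to E D f \<and> (\<exists>b. isUb UNIV (T ` D) b))}"

definition L1 :: "'u::{ordered_real_vector, lattice} set \<Rightarrow> ('u \<Rightarrow> 'u) \<Rightarrow> 'u set" where
  "L1 E T = {f1 - f2 | f1 f2. f1 \<in> natural_cone E T \<and> f2 \<in> natural_cone E T}"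

definition T_ext_cone ::
    "'u::{ordered_real_vector, lattice} set \<Rightarrow> ('u \<Rightarrow> 'u) \<Rightarrow> 'u \<Rightarrow> 'u" where
  "T_ext_cone E T f = (THE s. \<exists>D. increases_to E D f \<and> isLub UNIV (T ` D) s)"

definition T_ext :: "'u::{ordered_real_vector, lattice} set \<Rightarrow> ('u \<Rightarrow> 'u) \<Rightarrow> 'u \<Rightarrow> 'u" where
  "T_ext E T f = (THE t. \<exists>f1\<in>natural_cone E T. \<exists>f2\<in>natural_cone E T.
                  f = f1 - f2 \<and> t = T_ext_cone E T f1 - T_ext_cone E T f2)"

definition rangeT :: "'u::{ordered_real_vector, lattice} set \<Rightarrow> ('u \<Rightarrow> 'u) \<Rightarrow> 'u set" where
  "rangeT E T = T_ext E T ` L1 E T"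

definition L2 ::
    "'u::{ordered_real_vector, real_algebra, lattice_ring} set \<Rightarrow> ('u \<Rightarrow> 'u) \<Rightarrow> 'u set" where
  "L2 E T = {x \<in> L1 E T. x * x \<in> L1 E T}"

definition inner_T :: "'u::{ordered_real_vector, real_algebra, lattice_ring} set \<Rightarrow> ('u \<Rightarrow> 'u)
    \<Rightarrow> 'u \<Rightarrow> 'u \<Rightarrow> 'u" where
  "inner_T E T x y = T_ext E T (x * y)"

definition norm_T :: "'u::{ordered_real_vector, real_algebra, lattice_ring} set \<Rightarrow> ('u \<Rightarrow> 'u)
    \<Rightarrow> 'u \<Rightarrow> 'u" where
  "norm_T E T x = (THE r. r \<in> rangeT E T \<and> 0 \<le> r \<and> r * r = inner_T E T x x)"

section \<open>Operators on \<open>L\<^sup>2(T)\<close>\<close>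

text \<open>An operator on \<open>H\<close> is a function on the whole type that vanishes outside \<open>H\<close>.  With this
  convention equality of functions is equality of operators, and the vector space operations on
  operators are the pointwise ones.\<close>

definition A_linear ::
    "'u::{ordered_real_vector, real_algebra, lattice_ring} set \<Rightarrow> 'u set \<Rightarrow> ('u \<Rightarrow> 'u) \<Rightarrow> bool" where
  "A_linear A H S \<longleftrightarrow>
     (\<forall>x. x \<notin> H \<longrightarrow> S x = 0) \<and> S ` H \<subseteq> H \<and>
     (\<forall>x\<in>H. \<forall>y\<in>H. S (x + y) = S x + S y) \<and>
     (\<forall>a\<in>A. \<forall>x\<in>H. S (a * x) = a * S x)"

definition op_positive :: "'u::{zero, ord} set \<Rightarrow> ('u \<Rightarrow> 'u) \<Rightarrow> bool" where
  "op_positive H S \<longleftrightarrow> (\<forall>x\<in>H. 0 \<le> x \<longrightarrow> 0 \<le> S x)"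

definition op_le :: "'u::ordered_ab_group_add set \<Rightarrow> ('u \<Rightarrow> 'u) \<Rightarrow> ('u \<Rightarrow> 'u) \<Rightarrow> bool" where
  "op_le H R Q \<longleftrightarrow> op_positive H (\<lambda>x. Q x - R x)"

definition Lb :: "'u::{ordered_real_vector, real_algebra, lattice_ring} set \<Rightarrow> 'u set
    \<Rightarrow> ('u \<Rightarrow> 'u) set" where
  "Lb A H = {R. A_linear A H R \<and>
     (\<forall>a\<in>H. \<forall>b\<in>H. \<exists>c\<in>H. \<exists>d\<in>H. R ` ({a..b} \<inter> H) \<subseteq> {c..d})}"

text \<open>The modulus of \<open>R\<close> in the vector lattice \<open>Lb A H\<close>, that is, the supremum of \<open>R\<close> and \<open>- R\<close>.\<close>

definition op_modulus :: "'u::{ordered_real_vector, real_algebra, lattice_ring} set \<Rightarrow> 'u set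
    \<Rightarrow> ('u \<Rightarrow> 'u) \<Rightarrow> 'u \<Rightarrow> 'u" where
  "op_modulus A H R = (THE M. M \<in> Lb A H \<and> op_le H R M \<and> op_le H (\<lambda>x. - R x) M \<and>
     (\<forall>N\<in>Lb A H. op_le H R N \<and> op_le H (\<lambda>x. - R x) N \<longrightarrow> op_le H M N))"

definition order_ideal_Lb :: "'u::{ordered_real_vector, real_algebra, lattice_ring} set \<Rightarrow> 'u set
    \<Rightarrow> ('u \<Rightarrow> 'u) set \<Rightarrow> bool" where
  "order_ideal_Lb A H I \<longleftrightarrow>
     I \<subseteq> Lb A H \<and>
     (\<lambda>x. 0) \<in> I \<and> (\<forall>R\<in>I. \<forall>S\<in>I. (\<lambda>x. R x + S x) \<in> I) \<and> (\<forall>c. \<forall>S\<in>I. (\<lambda>x. c *\<^sub>R S x) \<in> I) \<and>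
     (\<forall>R\<in>Lb A H. \<forall>S\<in>I. op_le H (op_modulus A H R) (op_modulus A H S) \<longrightarrow> R \<in> I)"

text \<open>The Riesz--Kantorovich modulus: its values on the positive cone of \<open>H\<close> are the suprema
  \<open>rk_sup H R x\<close>, and it is extended to \<open>H\<close> through \<open>x = pprt x + nprt x\<close>,
  where \<open>nprt x = inf x 0\<close>.\<close>

definition rk_sup :: "'u::lattice_ab_group_add_abs set \<Rightarrow> ('u \<Rightarrow> 'u) \<Rightarrow> 'u \<Rightarrow> 'u" where
  "rk_sup H R x = (THE s. isLub H {\<bar>R u\<bar> | u. u \<in> H \<and> \<bar>u\<bar> \<le> x} s)"

definition rk_modulus :: "'u::lattice_ab_group_add_abs set \<Rightarrow> ('u \<Rightarrow> 'u) \<Rightarrow> 'u \<Rightarrow> 'u" where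
  "rk_modulus H R x = (if x \<in> H then rk_sup H R (pprt x) - rk_sup H R (- nprt x) else 0)"

definition BT :: "'u::{ordered_real_vector, real_algebra, lattice_ring} set \<Rightarrow> ('u \<Rightarrow> 'u)
    \<Rightarrow> ('u \<Rightarrow> 'u) set" where
  "BT E T = {S. A_linear (rangeT E T) (L2 E T) S \<and>
     (\<exists>k\<in>rangeT E T. 0 \<le> k \<and> (\<forall>x\<in>L2 E T. norm_T E T (S x) \<le> k * norm_T E T x))}"

definition BT_pos :: "'u::{ordered_real_vector, real_algebra, lattice_ring} set \<Rightarrow> ('u \<Rightarrow> 'u)
    \<Rightarrow> ('u \<Rightarrow> 'u) set" where
  "BT_pos E T = {S \<in> BT E T. op_positive (L2 E T) S}"

definition BT_reg :: "'u::{ordered_real_vector, real_algebra, lattice_ring} set \<Rightarrow> ('u \<Rightarrow> 'u)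
    \<Rightarrow> ('u \<Rightarrow> 'u) set" where
  "BT_reg E T = {(\<lambda>x. P x - Q x) | P Q. P \<in> BT_pos E T \<and> Q \<in> BT_pos E T}"

end

theory Submission
  imports Defs
begin

text \<open>
  A positive operator dominated by a strongly bounded one is strongly bounded, since
  \<open>\<bar>Q x\<bar> \<le> Q \<bar>x\<bar> \<le> P \<bar>x\<bar>\<close> and \<open>T\<close> is monotone.  This gives the positive cone; for the ideal
  property it applies to \<open>\<bar>R\<bar> \<le> \<bar>P - Q\<bar> \<le> P + Q\<close> and to \<open>\<bar>R\<bar> - R \<le> 2 \<bar>R\<bar>\<close>.

  The averaging property and the commutativity of the multiplication come from one observation: an
  element below \<open>\<bar>a - l e\<bar>\<close> for all real \<open>l\<close> is at most \<open>0\<close>, and defects such as \<open>T (a z) - a T z\<close> do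
  not change when \<open>a\<close> is replaced by \<open>a - l e\<close>.  The passage from bounded to unbounded elements rests
  on \<open>(a - n e)\<^sup>+ \<le> a\<^sup>2 / n\<close>.
\<close>

section \<open>Riesz spaces and unital f-algebras\<close>

text \<open>\<open>T_ext_cone\<close>, \<open>T_ext\<close>, \<open>norm_T\<close>,
  \<open>rk_sup\<close> and \<open>op_modulus\<close> are all defined by \<open>THE\<close>, so
  existence and uniqueness come before any computation. For the norm this means square roots in the
  range of T; their uniqueness rests on commutativity, which the sort of \<open>'u\<close> does not
  grant. The algebraic laws of the extended T are not hypotheses either: what is given is order
  continuity on E, and averaging over unbounded elements has to be recovered from it.
  \<open>cond_exp_ideal\<close> separates the two tasks: it collects order properties of a domain L,
  from which the theory of A, H and the operators is derived; the natural domain is then shown to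
  have these properties. The principle about |a - l e| has a pointwise reading: a function a has a
  real value at each point, so the infimum of |a - l e| over l vanishes there. The proof replaces
  points by a grid of mesh 1/m. Strong boundedness is handled in the root-free form
  \<open>T (S x * S x) \<le> k * k * T (x * x)\<close>.\<close>

lemma isLub_UNIV_iff:
  "isLub UNIV D s \<longleftrightarrow> (\<forall>d\<in>D. d \<le> s) \<and> (\<forall>b. (\<forall>d\<in>D. d \<le> b) \<longrightarrow> s \<le> b)"
  by (auto simp: isLub_def leastP_def isUb_def setle_def setge_def)

lemma isLub_eqI: "isLub S D s \<Longrightarrow> isLub S D t \<Longrightarrow> s = (t :: 'a :: order)"
  by (meson isLub_isUb isLub_le_isUb order.antisym)

lemma diff_inf_eq_pprt: "x - inf x y = pprt (x - y)" for x y :: "'a::lattice_ab_group_add"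
proof -
  have "x - inf x y = x + sup (- x) (- y)" by simp
  also have "\<dots> = sup 0 (x - y)" by (simp only: add_sup_distrib_left) simp
  finally show ?thesis by (simp add: pprt_def sup_commute)
qed

lemma pprt_minus_nprt: "pprt x + nprt x = x" for x :: "'a::lattice_ab_group_add"
  by (simp flip: prts)

lemma inf_pprt_nprt: "inf (pprt x) (- nprt x) = 0" for x :: "'a::lattice_ab_group_add"
proof -
  have "inf (pprt x) (- nprt x) + nprt x = inf (pprt x + nprt x) (- nprt x + nprt x)"
    by (rule add_inf_distrib_right)
  also have "\<dots> = inf x 0" by (simp add: pprt_minus_nprt)
  also have "\<dots> = 0 + nprt x" by (simp add: nprt_def)
  finally show ?thesis by (simp only: add_right_cancel)
qed

text \<open>Distributivity follows from translation invariance: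
  \<open>x + y = sup x y + inf x y\<close> bounds both y and z by \<open>?w + ?u - x\<close>, and
  the resulting bound on \<open>sup y z\<close> is turned back into one on
  \<open>inf x (sup y z)\<close> by the same identity.\<close>

lemma inf_sup_le: "inf x (sup y z) \<le> sup (inf x y) (inf x z)" for x y z :: "'a::lattice_ab_group_add"
proof -
  let ?u = "sup (inf x y) (inf x z)" and ?w = "sup x (sup y z)"
  have "x + y = sup x y + inf x y" "x + z = sup x z + inf x z" by (rule add_eq_inf_sup)+
  moreover have "sup x y + inf x y \<le> ?w + ?u" "sup x z + inf x z \<le> ?w + ?u"
    by (intro add_mono; simp add: le_supI1 le_supI2)+
  ultimately have "y \<le> ?w + ?u - x" "z \<le> ?w + ?u - x"
    by (simp_all add: le_diff_eq add.commute)
  then have "sup y z \<le> ?w + ?u - x" by simp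
  then have "x + sup y z \<le> ?w + ?u" by (simp add: le_diff_eq add.commute)
  then have "?w + inf x (sup y z) \<le> ?w + ?u" by (simp add: add_eq_inf_sup[symmetric])
  then show ?thesis by simp
qed

text \<open>The infinite distributive law, again through \<open>x + d = sup x d + inf x d\<close>: a
  bound b on all \<open>inf x d\<close> makes \<open>b - x + sup x f\<close> a bound on D.\<close>

lemma isLub_inf:
  fixes f :: "'a::lattice_ab_group_add"
  assumes "isLub UNIV D f"
  shows "isLub UNIV (inf x ` D) (inf x f)"
  unfolding isLub_UNIV_iff
proof (intro conjI ballI allI impI)
  fix y assume "y \<in> inf x ` D"
  then show "y \<le> inf x f" using assms by (auto simp: isLub_UNIV_iff intro: le_infI2)
next
  fix b assume b: "\<forall>d\<in>inf x ` D. d \<le> b"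
  have "d \<le> b - x + sup x f" if "d \<in> D" for d
  proof -
    have "x + d = sup x d + inf x d" by (rule add_eq_inf_sup)
    also have "\<dots> \<le> sup x f + b"
      using assms b that by (intro add_mono sup_mono) (auto simp: isLub_UNIV_iff)
    finally show ?thesis by (simp add: algebra_simps le_diff_eq)
  qed
  then have "f \<le> b - x + sup x f" using assms by (auto simp: isLub_UNIV_iff)
  then have "x + f \<le> sup x f + b" by (simp add: algebra_simps le_diff_eq)
  then have "sup x f + inf x f \<le> sup x f + b" by (simp only: add_eq_inf_sup[of x f])
  then show "inf x f \<le> b" by simp
qed

lemma abs_add_abs_eq_sup: "\<bar>a\<bar> + \<bar>b\<bar> = sup \<bar>a + b\<bar> \<bar>a - b\<bar>" for a b :: "'a::lattice_ab_group_add_abs"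
  by (simp add: abs_lattice add_sup_inf_distribs ac_simps)

lemma pprt_le_abs: "pprt x \<le> \<bar>x\<bar>" "- nprt x \<le> \<bar>x\<bar>" for x :: "'a::lattice_ab_group_add_abs"
  by (simp_all add: abs_prts)

lemma two_pprt: "pprt x + pprt x = \<bar>x\<bar> + x" for x :: "'a::lattice_ab_group_add_abs"
proof -
  have "\<bar>x\<bar> + x = (pprt x - nprt x) + (pprt x + nprt x)"
    by (simp only: abs_prts pprt_minus_nprt)
  then show ?thesis by simp
qed

locale unital_f_algebra =
  fixes e :: "'u::{ordered_real_vector, real_algebra, lattice_ring}"
  assumes complete: "dedekind_complete (UNIV :: 'u set)"
    and f_algebra: "f_algebra_with_unit e"
begin

lemma ex_isLub: "D \<noteq> {} \<Longrightarrow> (\<And>d. d \<in> D \<Longrightarrow> d \<le> b) \<Longrightarrow> \<exists>s::'u. isLub UNIV D s"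
  using complete unfolding dedekind_complete_def
  by (metis isUb_UNIV_I subset_UNIV)

text \<open>If s is the supremum of the multiples of x, then every multiple is also at most
  \<open>s - x\<close>, because the next multiple is at most s.\<close>

lemma archimedean:
  assumes "\<And>n::nat. real n *\<^sub>R x \<le> (y :: 'u)"
  shows "x \<le> 0"
proof -
  let ?D = "range (\<lambda>n::nat. real n *\<^sub>R x)"
  obtain s where s: "isLub UNIV ?D s"
    using ex_isLub[of ?D y] assms by auto
  have "real n *\<^sub>R x \<le> s - x" for n
  proof -
    have "real (Suc n) *\<^sub>R x \<le> s" using s unfolding isLub_UNIV_iff by blast
    then show ?thesis by (simp add: algebra_simps le_diff_eq)
  qed
  then have "s \<le> s - x" using s unfolding isLub_UNIV_iff by blast
  then show ?thesis by simp
qed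

text \<open>The form in which the Archimedean property is used: an error term z / n may be dropped
  once the estimate holds for every positive n.\<close>

lemma le_if_le_add_scaled:
  assumes "\<And>n::nat. 0 < n \<Longrightarrow> x \<le> y + (1 / real n) *\<^sub>R (z :: 'u)"
  shows "x \<le> y"
proof -
  have "real n *\<^sub>R (x - y) \<le> \<bar>z\<bar>" for n :: nat
  proof (cases "n = 0")
    case False
    then have "x - y \<le> (1 / real n) *\<^sub>R z" using assms[of n] by (simp add: algebra_simps)
    then have "real n *\<^sub>R (x - y) \<le> real n *\<^sub>R (1 / real n) *\<^sub>R z"
      by (intro scaleR_left_mono) auto
    also have "\<dots> = z" using False by simp
    also have "\<dots> \<le> \<bar>z\<bar>" by (rule abs_ge_self)
    finally show ?thesis .
  qed simp
  from archimedean[OF this] show ?thesis by simp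
qed

lemma unit_mult [simp]: "e * x = x" "x * e = x"
  using f_algebra unfolding f_algebra_with_unit_def by auto

text \<open>The f-algebra axiom is applied twice: x * y is disjoint from y, and then from
  itself.\<close>

lemma mult_disjoint:
  assumes "inf x y = (0::'u)" shows "x * y = 0"
proof -
  have x: "0 \<le> x" "0 \<le> y" using assms by (metis inf_le1, metis inf_le2)
  then have "inf y (x * y) = 0"
    using f_algebra assms unfolding f_algebra_with_unit_def by (metis inf_commute)
  with x f_algebra have "inf (x * y) (x * y) = 0" unfolding f_algebra_with_unit_def by blast
  then show ?thesis by simp
qed

lemma abs_mult_abs: "\<bar>x\<bar> * \<bar>x\<bar> = x * (x::'u)" and square_nonneg: "0 \<le> x * (x::'u)"
proof -
  \<comment> \<open>Positive and negative part are disjoint, so both mixed products vanish and x * x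
    is a sum of two squares of nonnegative elements.\<close>
  let ?p = "pprt x" and ?n = "- nprt x"
  have 0: "?p * ?n = 0" "?n * ?p = 0"
    using inf_pprt_nprt[of x] by (auto intro!: mult_disjoint simp: inf_commute simp del: mult_minus_left mult_minus_right)
  have "x * x = (?p - ?n) * (?p - ?n)" by (simp add: pprt_minus_nprt)
  also have "\<dots> = ?p * ?p + ?n * ?n" using 0 by (simp only: left_diff_distrib right_diff_distrib) simp
  finally have sq: "x * x = ?p * ?p + ?n * ?n" .
  have "0 \<le> ?p * ?p + ?n * ?n"
    by (intro add_nonneg_nonneg mult_nonneg_nonneg) auto
  then show "0 \<le> x * x" using sq by simp
  have "\<bar>x\<bar> * \<bar>x\<bar> = (?p + ?n) * (?p + ?n)" by (simp add: abs_prts)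
  also have "\<dots> = ?p * ?p + ?n * ?n" using 0 by (simp only: distrib_left distrib_right) simp
  finally show "\<bar>x\<bar> * \<bar>x\<bar> = x * x" using sq by simp
qed

lemma unit_nonneg [simp]: "0 \<le> e"
  using square_nonneg[of e] by simp

lemma scaled_unit_nonneg [simp]: "0 \<le> c \<Longrightarrow> 0 \<le> c *\<^sub>R e"
  by (simp add: scaleR_nonneg_nonneg)

lemma pprt_diff_unit_le:
  assumes "0 < n"
  shows "pprt (a - real n *\<^sub>R e) \<le> (1 / real n) *\<^sub>R (a * a)"
proof -
  \<comment> \<open>The centre n / 2 produces exactly the linear term - n a. Enlarging the constant
    n * n / 4 to n * n then lets n be factored out of n a - n * n e.\<close>
  have "0 \<le> (a - (real n / 2) *\<^sub>R e) * (a - (real n / 2) *\<^sub>R e)" by (rule square_nonneg)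
  also have "\<dots> = a * a - real n *\<^sub>R a + (real n * real n / 4) *\<^sub>R e"
    by (simp add: algebra_simps flip: scaleR_left.add)
  also have "\<dots> \<le> a * a - real n *\<^sub>R a + (real n * real n) *\<^sub>R e"
    by (intro add_left_mono scaleR_right_mono) auto
  finally have "real n *\<^sub>R (a - real n *\<^sub>R e) \<le> a * a"
    by (simp add: algebra_simps)
  then have "(1 / real n) *\<^sub>R real n *\<^sub>R (a - real n *\<^sub>R e) \<le> (1 / real n) *\<^sub>R (a * a)"
    by (intro scaleR_left_mono) auto
  then have "a - real n *\<^sub>R e \<le> (1 / real n) *\<^sub>R (a * a)" using assms by simp
  moreover have "0 \<le> (1 / real n) *\<^sub>R (a * a)"
    by (intro scaleR_nonneg_nonneg square_nonneg) auto
  ultimately show ?thesis by (simp add: pprt_def)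
qed

lemma trunc_decomp: "a = inf a c + pprt (a - c)" for a :: 'u
  by (metis add.commute diff_add_cancel diff_inf_eq_pprt)

text \<open>By \<open>trunc_decomp\<close> and \<open>pprt_diff_unit_le\<close> the truncation at n
  e misses a by at most a * a / n, an error that \<open>le_if_le_add_scaled\<close> removes.\<close>

lemma isLub_trunc:
  assumes "0 \<le> a"
  shows "isLub UNIV (range (\<lambda>n::nat. inf a (real n *\<^sub>R e))) a"
  unfolding isLub_UNIV_iff
proof (intro conjI ballI allI impI)
  fix b assume b: "\<forall>d\<in>range (\<lambda>n::nat. inf a (real n *\<^sub>R e)). d \<le> b"
  show "a \<le> b"
  proof (rule le_if_le_add_scaled[of _ _ "a * a"])
    fix n :: nat assume "0 < n"
    have "inf a (real n *\<^sub>R e) + pprt (a - real n *\<^sub>R e) \<le> b + (1 / real n) *\<^sub>R (a * a)"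
      using b pprt_diff_unit_le[OF \<open>0 < n\<close>, of a] by (intro add_mono) auto
    then show "a \<le> b + (1 / real n) *\<^sub>R (a * a)" using trunc_decomp by metis
  qed
qed auto

lemma le_zero_if_le_abs_diff:
  assumes "0 \<le> a" and h: "\<And>l::real. h \<le> \<bar>a - l *\<^sub>R e\<bar>"
  shows "h \<le> 0"
proof (rule le_if_le_add_scaled[of _ _ e])
  fix m :: nat assume "0 < m"
  define \<delta> where "\<delta> = 1 / real m"
  have \<delta>: "0 < \<delta>" using \<open>0 < m\<close> by (simp add: \<delta>_def)
  let ?d = "\<delta> *\<^sub>R e"
  have d0: "0 \<le> ?d" using \<delta> by simp
  \<comment> \<open>Walking up the grid: pointwise, either h is at most the mesh, or a is so large
    that h \<le> a - k \<delta>. Far up the grid the second alternative survives only on the tail of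
    a.\<close>
  have step: "h \<le> sup ?d (a - (real k * \<delta>) *\<^sub>R e)" for k :: nat
  proof (induction k)
    case 0
    show ?case using h[of 0] assms(1) by (simp add: le_supI2)
  next
    case (Suc k)
    define t where "t = a - (real k * \<delta>) *\<^sub>R e"
    have eq: "a - (real (Suc k) * \<delta>) *\<^sub>R e = t - ?d" by (simp add: t_def algebra_simps)
    \<comment> \<open>Pointwise, t \<le> \<open>?d\<close> makes the old bound equal to
      \<open>?d\<close>, and otherwise the new bound is t - \<open>?d\<close>. Without points,
      \<open>inf_sup_le\<close> splits the infimum; the mixed term \<open>inf (?d - t) t\<close> is
      harmless because twice it is at most (\<open>?d\<close> - t) + t = \<open>?d\<close>.\<close>
    have "h \<le> inf (sup ?d t) (sup (t - ?d) (?d - t))"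
      using Suc h[of "real (Suc k) * \<delta>"] unfolding eq by (simp add: t_def abs_lattice)
    also have "\<dots> \<le> sup (inf (sup ?d t) (t - ?d)) (inf (sup ?d t) (?d - t))"
      by (rule inf_sup_le)
    also have "\<dots> \<le> sup ?d (t - ?d)"
    proof (rule le_supI)
      show "inf (sup ?d t) (t - ?d) \<le> sup ?d (t - ?d)" by (simp add: le_infI2)
      have "inf (?d - t) (sup ?d t) \<le> sup (inf (?d - t) ?d) (inf (?d - t) t)" by (rule inf_sup_le)
      also have "\<dots> \<le> ?d"
      proof (rule le_supI)
        have "inf (?d - t) t + inf (?d - t) t \<le> (?d - t) + t" by (intro add_mono) auto
        also have "\<dots> \<le> ?d + ?d" using d0 by simp
        finally have "0 \<le> (?d - inf (?d - t) t) + (?d - inf (?d - t) t)"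
          by (simp add: algebra_simps del: neg_inf_eq_sup diff_inf_eq_sup)
        then show "inf (?d - t) t \<le> ?d"
          by (simp del: neg_inf_eq_sup diff_inf_eq_sup)
      qed simp
      finally show "inf (sup ?d t) (?d - t) \<le> sup ?d (t - ?d)"
        by (simp add: inf_commute le_supI1)
    qed
    finally show ?case unfolding eq .
  qed
  have "h \<le> ?d + (1 / real n) *\<^sub>R (m *\<^sub>R (a * a))" if "0 < n" for n :: nat
  proof -
    \<comment> \<open>The grid has mesh 1 / m, so its point number n * m is n itself.\<close>
    have "h \<le> sup ?d (a - real n *\<^sub>R e)"
      using step[of "n * m"] \<open>0 < m\<close> by (simp add: \<delta>_def)
    also have "\<dots> \<le> ?d + pprt (a - real n *\<^sub>R e)"
      using d0 by (simp add: pprt_def add_increasing)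
    also have "\<dots> \<le> ?d + (1 / real n) *\<^sub>R (a * a)"
      using pprt_diff_unit_le[OF \<open>0 < n\<close>] by simp
    also have "\<dots> \<le> ?d + (1 / real n) *\<^sub>R (m *\<^sub>R (a * a))"
    proof -
      have "1 *\<^sub>R (a * a) \<le> m *\<^sub>R (a * a)"
        using \<open>0 < m\<close> by (intro scaleR_right_mono square_nonneg) auto
      then show ?thesis by (intro add_left_mono scaleR_left_mono) auto
    qed
    finally show ?thesis .
  qed
  from le_if_le_add_scaled[OF this] show "h \<le> 0 + (1 / real m) *\<^sub>R e"
    by (simp add: \<delta>_def)
qed

section \<open>Commutativity of the multiplication\<close>

lemma mult_commute_bounded:
  assumes "0 \<le> x" "0 \<le> y" "y \<le> real n *\<^sub>R e"
  shows "x * y = y * x"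
proof -
  have "\<bar>x * y - y * x\<bar> \<le> (2 * n) *\<^sub>R \<bar>x - l *\<^sub>R e\<bar>" for l
  proof -
    let ?z = "x - l *\<^sub>R e"
    have "x * y - y * x = ?z * y - y * ?z" by (simp add: algebra_simps)
    also have "\<bar>\<dots>\<bar> \<le> \<bar>?z * y\<bar> + \<bar>y * ?z\<bar>" by (rule abs_triangle_ineq4)
    also have "\<dots> \<le> \<bar>?z\<bar> * \<bar>y\<bar> + \<bar>y\<bar> * \<bar>?z\<bar>" by (intro add_mono abs_le_mult)
    also have "\<dots> \<le> \<bar>?z\<bar> * (real n *\<^sub>R e) + (real n *\<^sub>R e) * \<bar>?z\<bar>"
      using assms by (intro add_mono mult_left_mono mult_right_mono) auto
    also have "\<dots> = (2 * n) *\<^sub>R \<bar>?z\<bar>" by (simp flip: scaleR_left.add)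
    finally show ?thesis .
  qed
  then have "(1 / (2 * real n)) *\<^sub>R \<bar>x * y - y * x\<bar> \<le> (1 / (2 * real n)) *\<^sub>R (2 * n) *\<^sub>R \<bar>x - l *\<^sub>R e\<bar>" for l
    by (intro scaleR_left_mono) auto
  \<comment> \<open>For n = 0 the factor 1 / (2 n) is 0 and the inequality is trivial; that case is
    settled separately below, where it forces y = 0.\<close>
  then have "(1 / (2 * real n)) *\<^sub>R \<bar>x * y - y * x\<bar> \<le> \<bar>x - l *\<^sub>R e\<bar>" for l
    using \<open>0 \<le> x\<close> by (cases "n = 0") auto
  from le_zero_if_le_abs_diff[OF \<open>0 \<le> x\<close> this]
  have le: "(1 / (2 * real n)) *\<^sub>R \<bar>x * y - y * x\<bar> \<le> 0" .
  show ?thesis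
  proof (cases "n = 0")
    case True
    with assms have "y = 0" by auto
    then show ?thesis by simp
  next
    case False
    have "(2 * real n) *\<^sub>R ((1 / (2 * real n)) *\<^sub>R \<bar>x * y - y * x\<bar>) \<le> (2 * real n) *\<^sub>R 0"
      by (rule scaleR_left_mono[OF le]) simp
    then show ?thesis using False by simp
  qed
qed

text \<open>The truncation of y at n e commutes with x, so the commutator of x and y is that of x
  and the tail, which is of order 1 / n.\<close>

lemma mult_commute_nonneg:
  assumes "0 \<le> x" "0 \<le> y"
  shows "x * y = y * (x::'u)"
proof -
  have "\<bar>x * y - y * x\<bar> \<le> 0 + (1 / real n) *\<^sub>R (x * (y * y) + (y * y) * x)" if "0 < n" for n
  proof -
    let ?t = "inf y (real n *\<^sub>R e)" and ?p = "pprt (y - real n *\<^sub>R e)"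
    have "x * ?t = ?t * x" using assms by (intro mult_commute_bounded[of _ _ n]) auto
    moreover have "y = ?t + ?p" by (rule trunc_decomp)
    ultimately have "x * y - y * x = x * ?p - ?p * x"
      by (metis (no_types, lifting) add_diff_cancel_left distrib_left distrib_right)
    also have "\<bar>\<dots>\<bar> \<le> \<bar>x * ?p\<bar> + \<bar>?p * x\<bar>" by (rule abs_triangle_ineq4)
    also have "\<dots> = x * ?p + ?p * x" using assms by simp
    also have "\<dots> \<le> x * ((1 / real n) *\<^sub>R (y * y)) + ((1 / real n) *\<^sub>R (y * y)) * x"
      using assms pprt_diff_unit_le[OF that, of y] by (intro add_mono mult_left_mono mult_right_mono) auto
    finally show ?thesis by (simp add: algebra_simps)
  qed
  from le_if_le_add_scaled[OF this] show ?thesis by simp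
qed

lemma mult_commute: "x * y = y * (x::'u)"
proof -
  have nonneg: "(x::'u) * y = y * x" if "0 \<le> y" for x y
  proof -
    have "(pprt x - (- nprt x)) * y = y * (pprt x - (- nprt x))"
      unfolding left_diff_distrib right_diff_distrib
      using that by (intro arg_cong2[of _ _ _ _ minus] mult_commute_nonneg) auto
    then show ?thesis by (simp add: pprt_minus_nprt)
  qed
  have "x * (pprt y - (- nprt y)) = (pprt y - (- nprt y)) * x"
    unfolding left_diff_distrib right_diff_distrib
    by (intro arg_cong2[of _ _ _ _ minus] nonneg) auto
  then show ?thesis by (simp add: pprt_minus_nprt)
qed

section \<open>Nilpotents and the order of squares\<close>

lemma square_eq_0:
  assumes "c * c = 0" "0 \<le> c" shows "c = (0::'u)"
proof -
  have "real n *\<^sub>R c \<le> (1/2) *\<^sub>R e" for n :: nat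
  proof -
    \<comment> \<open>The quadratic term vanishes by assumption, so positivity of the square bounds
      2 n c by e for every n.\<close>
    have "0 \<le> (e - real n *\<^sub>R c) * (e - real n *\<^sub>R c)" by (rule square_nonneg)
    also have "\<dots> = e - 2 *\<^sub>R real n *\<^sub>R c" using assms
      by (simp add: algebra_simps flip: scaleR_left.add)
    finally have "2 *\<^sub>R real n *\<^sub>R c \<le> e" by simp
    then have "(1/2) *\<^sub>R 2 *\<^sub>R real n *\<^sub>R c \<le> (1/2) *\<^sub>R e" by (intro scaleR_left_mono) auto
    then show ?thesis by simp
  qed
  from archimedean[OF this] assms show ?thesis by simp
qed

text \<open>Let c be the positive part of a - b. Then c (a - b) = c c, hence c c (a + b) = c (a a -
  b b) \<le> 0, whereas c \<le> a gives c c c \<le> c c (a + b). So c is nilpotent, and two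
  applications of \<open>square_eq_0\<close> give c = 0.\<close>

lemma square_le_imp_le:
  assumes "0 \<le> a" "0 \<le> b" "a * a \<le> b * (b::'u)"
  shows "a \<le> b"
proof -
  define c where "c = pprt (a - b)"
  have c: "0 \<le> c" by (simp add: c_def)
  have "c \<le> a" using assms by (simp add: c_def pprt_def)
  have "c * (- nprt (a - b)) = 0" unfolding c_def by (intro mult_disjoint inf_pprt_nprt)
  then have "c * (a - b) = c * c"
    by (metis c_def add.right_neutral distrib_left minus_zero mult_minus_right neg_equal_iff_equal pprt_minus_nprt)
  then have "c * c * (a + b) = c * ((a - b) * (a + b))" by (simp add: mult.assoc[symmetric])
  also have "(a - b) * (a + b) = a * a - b * b" by (simp add: algebra_simps mult_commute)
  also have "c * (a * a - b * b) \<le> 0" using c assms by (simp add: mult_nonneg_nonpos)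
  finally have "c * c * (a + b) \<le> 0" .
  moreover have "c * c * c \<le> c * c * (a + b)"
    using \<open>c \<le> a\<close> assms c by (intro mult_left_mono) (auto simp: add_increasing2)
  ultimately have "c * c * c \<le> 0" by order
  then have "c * c * c = 0" using c by (simp add: order.antisym)
  then have "(c * c) * (c * c) = 0" by (metis mult.assoc mult_zero_left)
  from square_eq_0[OF square_eq_0[OF this square_nonneg] c] have "c = 0" .
  then show ?thesis by (simp add: c_def flip: le_zero_iff_zero_pprt)
qed

text \<open>Both sides are nonnegative and have the same square.\<close>

lemma abs_mult_nonneg:
  assumes "0 \<le> (a::'u)" shows "\<bar>a * x\<bar> = a * \<bar>x\<bar>"
proof -
  have "(a * \<bar>x\<bar>) * (a * \<bar>x\<bar>) = (a * a) * (\<bar>x\<bar> * \<bar>x\<bar>)" by (metis mult.assoc mult_commute)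
  also have "\<dots> = (a * x) * (a * x)" unfolding abs_mult_abs by (metis mult.assoc mult_commute)
  also have "\<dots> = \<bar>a * x\<bar> * \<bar>a * x\<bar>" by (simp only: abs_mult_abs)
  finally have "\<bar>a * x\<bar> * \<bar>a * x\<bar> = (a * \<bar>x\<bar>) * (a * \<bar>x\<bar>)" by simp
  then show ?thesis using assms
    by (metis abs_ge_zero mult_nonneg_nonneg order.antisym order.refl square_le_imp_le)
qed

lemma isLub_mult_left:
  assumes s: "isLub UNIV D s" and nonneg: "\<And>d. d \<in> D \<Longrightarrow> 0 \<le> d" "0 \<le> s" "0 \<le> (a::'u)"
  shows "isLub UNIV ((*) a ` D) (a * s)"
  unfolding isLub_UNIV_iff
proof (intro conjI ballI allI impI)
  fix y assume "y \<in> (*) a ` D"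
  then show "y \<le> a * s" using assms by (auto simp: isLub_UNIV_iff intro: mult_left_mono)
next
  fix b assume b: "\<forall>d\<in>(*) a ` D. d \<le> b"
  show "a * s \<le> b"
    \<comment> \<open>The part of \<open>a\<close> bounded by \<open>n e\<close> multiplies \<open>s - d\<close> at most by \<open>n\<close>.\<close>
  proof (rule le_if_le_add_scaled[of _ _ "a * a * s"])
    fix n :: nat assume n: "0 < n"
    let ?t = "inf a (real n *\<^sub>R e)" and ?p = "pprt (a - real n *\<^sub>R e)"
    have "d \<le> s - (1 / real n) *\<^sub>R (?t * s - b)" if "d \<in> D" for d
    proof -
      have "?t * s - b \<le> ?t * s - ?t * d"
      proof -
        have "?t * d \<le> a * d" using nonneg that by (intro mult_right_mono) auto
        also have "\<dots> \<le> b" using b that by auto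
        finally show ?thesis by simp
      qed
      also have "\<dots> = ?t * (s - d)" by (simp add: right_diff_distrib)
      also have "\<dots> \<le> (real n *\<^sub>R e) * (s - d)"
        using s that by (intro mult_right_mono) (auto simp: isLub_UNIV_iff)
      finally have "(1 / real n) *\<^sub>R (?t * s - b) \<le> (1 / real n) *\<^sub>R real n *\<^sub>R (s - d)"
        by (intro scaleR_left_mono) auto
      then show ?thesis using n by (simp add: algebra_simps)
    qed
    then have "s \<le> s - (1 / real n) *\<^sub>R (?t * s - b)" using s by (auto simp: isLub_UNIV_iff)
    then have "real n *\<^sub>R (1 / real n) *\<^sub>R (?t * s - b) \<le> real n *\<^sub>R 0"
      by (intro scaleR_left_mono) auto
    then have "?t * s \<le> b" using n by simp
    moreover have "?p * s \<le> ((1 / real n) *\<^sub>R (a * a)) * s"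
      using nonneg pprt_diff_unit_le[OF n] by (intro mult_right_mono) auto
    ultimately have "?t * s + ?p * s \<le> b + (1 / real n) *\<^sub>R (a * a * s)"
      by (intro add_mono) auto
    then show "a * s \<le> b + (1 / real n) *\<^sub>R (a * a * s)"
      using trunc_decomp by (metis distrib_right)
  qed
qed

end

section \<open>Conditional expectations on an ideal\<close>

text \<open>The assumption \<open>T_levi\<close> carries the analytic content: it combines order
  continuity with the maximality of the domain, since the supremum of a directed set with bounded
  expectations lands in L and inherits the bound. Averaging is derived from it and is not among the
  assumptions.\<close>

locale cond_exp_ideal = unital_f_algebra e
  for e :: "'u::{ordered_real_vector, real_algebra, lattice_ring}" +
  fixes L :: "'u set" and T :: "'u \<Rightarrow> 'u"
  assumes L_solid: "x \<in> L \<Longrightarrow> \<bar>y\<bar> \<le> \<bar>x\<bar> \<Longrightarrow> y \<in> L"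
    and L_add: "x \<in> L \<Longrightarrow> y \<in> L \<Longrightarrow> x + y \<in> L"
    and L_scaleR: "x \<in> L \<Longrightarrow> c *\<^sub>R x \<in> L"
    and L_unit: "e \<in> L"
    and T_unit: "T e = e"
    and T_in_L: "x \<in> L \<Longrightarrow> T x \<in> L"
    and T_add: "x \<in> L \<Longrightarrow> y \<in> L \<Longrightarrow> T (x + y) = T x + T y"
    and T_scaleR: "x \<in> L \<Longrightarrow> T (c *\<^sub>R x) = c *\<^sub>R T x"
    and T_nonneg: "x \<in> L \<Longrightarrow> 0 \<le> x \<Longrightarrow> 0 \<le> T x"
    and T_idem: "x \<in> L \<Longrightarrow> T (T x) = T x"
    and T_strict: "x \<in> L \<Longrightarrow> 0 \<le> x \<Longrightarrow> T x = 0 \<Longrightarrow> x = 0"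
    and T_levi: "D \<subseteq> L \<Longrightarrow> (\<And>d. d \<in> D \<Longrightarrow> 0 \<le> d) \<Longrightarrow> up_directed D \<Longrightarrow> isLub UNIV D f \<Longrightarrow>
      (\<And>d. d \<in> D \<Longrightarrow> T d \<le> b) \<Longrightarrow> f \<in> L \<and> T f \<le> b"
begin

lemma L_minus: "x \<in> L \<Longrightarrow> - x \<in> L"
  using L_scaleR[of x "-1"] by simp

lemma L_diff: "x \<in> L \<Longrightarrow> y \<in> L \<Longrightarrow> x - y \<in> L"
  using L_add[of x "- y"] L_minus by simp

lemma L_abs: "x \<in> L \<Longrightarrow> \<bar>x\<bar> \<in> L"
  by (rule L_solid[of x]) auto

lemma L_between: "x \<in> L \<Longrightarrow> 0 \<le> y \<Longrightarrow> y \<le> x \<Longrightarrow> y \<in> L"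
  by (rule L_solid[of x]) auto

lemma L_pprt: "x \<in> L \<Longrightarrow> pprt x \<in> L"
  by - (rule L_between[of "\<bar>x\<bar>"], auto simp: L_abs pprt_le_abs)

lemma L_nprt: "x \<in> L \<Longrightarrow> nprt x \<in> L"
  using L_pprt[of "- x"] L_minus by (metis minus_minus pprt_neg)

lemma T_minus: "x \<in> L \<Longrightarrow> T (- x) = - T x"
  using T_scaleR[of x "-1"] by simp

lemma T_diff: "x \<in> L \<Longrightarrow> y \<in> L \<Longrightarrow> T (x - y) = T x - T y"
  using T_add[of x "- y"] T_minus L_minus by simp

lemma T_mono: "x \<in> L \<Longrightarrow> y \<in> L \<Longrightarrow> x \<le> y \<Longrightarrow> T x \<le> T y"
  using T_nonneg[of "y - x"] T_diff L_diff by simp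

lemma T_abs: "x \<in> L \<Longrightarrow> \<bar>T x\<bar> \<le> T \<bar>x\<bar>"
  using T_mono[of x "\<bar>x\<bar>"] T_mono[of "- x" "\<bar>x\<bar>"] L_abs L_minus T_minus
  by (intro abs_leI) (auto simp: abs_ge_self abs_ge_minus_self)

section \<open>The range of the expectation as an order-closed Riesz subspace\<close>

abbreviation A where "A \<equiv> T ` L"

lemma A_iff: "a \<in> A \<longleftrightarrow> a \<in> L \<and> T a = a"
  using T_in_L T_idem by (metis (no_types, lifting) image_iff)

lemma A_add: "a \<in> A \<Longrightarrow> b \<in> A \<Longrightarrow> a + b \<in> A"
  by (simp add: A_iff L_add T_add)

lemma A_diff: "a \<in> A \<Longrightarrow> b \<in> A \<Longrightarrow> a - b \<in> A"
  by (simp add: A_iff L_diff T_diff)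

lemma A_scaleR: "a \<in> A \<Longrightarrow> c *\<^sub>R a \<in> A"
  by (simp add: A_iff L_scaleR T_scaleR)

lemma A_unit: "e \<in> A"
  by (simp add: A_iff L_unit T_unit)

lemma A_zero: "0 \<in> A"
  using A_scaleR[OF A_unit, of 0] by simp

text \<open>Strict positivity is what makes the range a sublattice: \<bar>a\<bar> \<le> T
  \<bar>a\<bar>, and T annihilates the difference by idempotence.\<close>

lemma A_abs:
  assumes "a \<in> A" shows "\<bar>a\<bar> \<in> A"
proof -
  have a: "a \<in> L" "T a = a" using assms by (auto simp: A_iff)
  have "\<bar>a\<bar> \<le> T \<bar>a\<bar>" using T_abs[OF a(1)] a(2) by simp
  moreover have "T (T \<bar>a\<bar> - \<bar>a\<bar>) = 0" using a by (simp add: T_diff T_in_L L_abs T_idem)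
  ultimately have "T \<bar>a\<bar> - \<bar>a\<bar> = 0" using a by - (rule T_strict, auto intro: L_diff T_in_L L_abs)
  then show ?thesis using a by (simp add: A_iff L_abs)
qed

lemma A_pprt:
  assumes "a \<in> A" shows "pprt a \<in> A"
proof -
  have "(1/2) *\<^sub>R (pprt a + pprt a) = (1/2) *\<^sub>R (\<bar>a\<bar> + a)" by (simp only: two_pprt)
  then have "pprt a = (1/2) *\<^sub>R (\<bar>a\<bar> + a)" by (simp flip: scaleR_2)
  then show ?thesis using assms A_abs A_add A_scaleR by metis
qed

lemma A_nprt: "a \<in> A \<Longrightarrow> - nprt a \<in> A"
  using A_pprt[of "- a"] A_scaleR[of a "-1"] by (simp add: pprt_neg)

lemma A_inf:
  assumes "a \<in> A" "b \<in> A" shows "inf a b \<in> A"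
proof -
  have "inf a b = a - pprt (a - b)" by (metis add_diff_cancel_right' trunc_decomp)
  then show ?thesis using assms A_diff A_pprt by simp
qed

lemma A_sup:
  assumes "a \<in> A" "b \<in> A" shows "sup a b \<in> A"
proof -
  have "sup a b = a + b - inf a b" by (simp only: add_eq_inf_sup[of a b] add_diff_cancel_right')
  then show ?thesis using assms A_diff A_add A_inf by metis
qed

text \<open>\<open>T_levi\<close> with the bound s gives T s \<le> s; conversely every d = T d lies
  below T s, hence so does s.\<close>

lemma A_isLub:
  assumes "D \<subseteq> A" "\<And>d. d \<in> D \<Longrightarrow> 0 \<le> d" "up_directed D" and s: "isLub UNIV D s"
  shows "s \<in> A"
proof -
  have D: "d \<in> L" "T d = d" "d \<le> s" if "d \<in> D" for d
    using that assms(1) s by (auto simp: A_iff isLub_UNIV_iff subset_iff)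
  have s': "s \<in> L \<and> T s \<le> s" using D assms by (intro T_levi[of D]) auto
  then have "d \<le> T s" if "d \<in> D" for d using D[OF that] T_mono[of d s] by simp
  then have "s \<le> T s" using s by (simp add: isLub_UNIV_iff)
  with s' show ?thesis by (simp add: A_iff)
qed

section \<open>The averaging property\<close>

lemma averaging_bounded:
  assumes a: "a \<in> A" "0 \<le> a" and z: "0 \<le> z" "z \<le> real n *\<^sub>R e"
  shows "a * z \<in> L" "T (a * z) = a * T z"
proof -
  have aL: "a \<in> L" using a by (simp add: A_iff)
  have zL: "z \<in> L" using z by - (rule L_between[of "real n *\<^sub>R e"], auto intro: L_scaleR L_unit)
  have "a * z \<le> a * (real n *\<^sub>R e)" using a z by (intro mult_left_mono) auto
  then show az: "a * z \<in> L"
    using a z aL by - (rule L_between[of "real n *\<^sub>R a"], auto intro: L_scaleR)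
  have Tz: "0 \<le> T z" "T z \<le> real n *\<^sub>R e"
    using z zL T_mono[of z "real n *\<^sub>R e"] by (auto simp: T_nonneg L_scaleR L_unit T_unit T_scaleR)
  have "\<bar>T (a * z) - a * T z\<bar> \<le> (2 * n) *\<^sub>R \<bar>a - l *\<^sub>R e\<bar>" for l
  proof -
    let ?c = "a - l *\<^sub>R e"
    \<comment> \<open>T fixes \<bar>a - l e\<bar>, so the bound on \<open>?c * z\<close> passes
      through T unchanged. This makes the defect comparable with \<bar>a - l e\<bar> itself and not
      merely with its expectation.\<close>
    have cA: "?c \<in> A" by (intro A_diff a A_scaleR A_unit)
    then have c: "\<bar>?c\<bar> \<in> L" "T \<bar>?c\<bar> = \<bar>?c\<bar>" using A_abs A_iff by blast+
    have cz: "?c * z = a * z - l *\<^sub>R z" by (simp add: algebra_simps)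
    have czL: "?c * z \<in> L" unfolding cz by (intro L_diff az L_scaleR zL)
    have T_cz: "T (?c * z) = T (a * z) - l *\<^sub>R T z" unfolding cz
      using az zL by (simp add: T_diff T_scaleR L_scaleR)
    have le: "\<bar>?c * z\<bar> \<le> real n *\<^sub>R \<bar>?c\<bar>"
    proof -
      have "\<bar>?c * z\<bar> \<le> \<bar>?c\<bar> * \<bar>z\<bar>" by (rule abs_le_mult)
      also have "\<dots> \<le> \<bar>?c\<bar> * (real n *\<^sub>R e)" using z by (intro mult_left_mono) auto
      finally show ?thesis by simp
    qed
    have "T (a * z) - a * T z = T (?c * z) - ?c * T z" using T_cz by (simp add: algebra_simps)
    also have "\<bar>\<dots>\<bar> \<le> \<bar>T (?c * z)\<bar> + \<bar>?c * T z\<bar>" by (rule abs_triangle_ineq4)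
    also have "\<dots> \<le> T \<bar>?c * z\<bar> + \<bar>?c\<bar> * \<bar>T z\<bar>" by (intro add_mono abs_le_mult T_abs czL)
    also have "\<dots> \<le> T (real n *\<^sub>R \<bar>?c\<bar>) + \<bar>?c\<bar> * (real n *\<^sub>R e)"
      using Tz by (intro add_mono mult_left_mono T_mono L_abs czL L_scaleR c le) auto
    also have "\<dots> = (2 * n) *\<^sub>R \<bar>?c\<bar>" using c by (simp add: T_scaleR flip: scaleR_left.add)
    finally show ?thesis .
  qed
  then have "(1 / (2 * real n)) *\<^sub>R \<bar>T (a * z) - a * T z\<bar> \<le> (1 / (2 * real n)) *\<^sub>R (2 * n) *\<^sub>R \<bar>a - l *\<^sub>R e\<bar>" for l
    by (intro scaleR_left_mono) auto
  then have "(1 / (2 * real n)) *\<^sub>R \<bar>T (a * z) - a * T z\<bar> \<le> \<bar>a - l *\<^sub>R e\<bar>" for l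
    by (cases "n = 0") auto
  from le_zero_if_le_abs_diff[OF a(2) this]
  have le: "(1 / (2 * real n)) *\<^sub>R \<bar>T (a * z) - a * T z\<bar> \<le> 0" .
  show "T (a * z) = a * T z"
  proof (cases "n = 0")
    case True
    with Tz z have "T z = 0" "z = 0" by auto
    then show ?thesis by simp
  next
    case False
    have "(2 * real n) *\<^sub>R ((1 / (2 * real n)) *\<^sub>R \<bar>T (a * z) - a * T z\<bar>) \<le> (2 * real n) *\<^sub>R 0"
      by (rule scaleR_left_mono[OF le]) simp
    then show ?thesis using False by simp
  qed
qed

lemma up_directed_range_mono: "mono f \<Longrightarrow> up_directed (range (f :: nat \<Rightarrow> 'u))"
  unfolding up_directed_def by (auto simp: mono_def) (metis nle_le)

lemma mono_trunc: "mono (\<lambda>n::nat. inf z (real n *\<^sub>R e))"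
  by (intro monoI inf_mono scaleR_right_mono) auto

lemma averaging_nonneg:
  assumes a: "a \<in> A" "0 \<le> a" and z: "z \<in> L" "0 \<le> z"
  shows "a * z \<in> L" "T (a * z) = a * T z"
proof -
  let ?t = "\<lambda>n::nat. inf z (real n *\<^sub>R e)"
  have t0: "0 \<le> ?t n" for n using z by simp
  have tL: "?t n \<in> L" for n using z by - (rule L_between[of z], auto)
  have avg: "a * ?t n \<in> L" "T (a * ?t n) = a * T (?t n)" for n
    using averaging_bounded[of a "?t n" n] a z by auto
  have t_lub: "isLub UNIV (range ?t) z" by (rule isLub_trunc[OF z(2)])
  have "isLub UNIV ((*) a ` range ?t) (a * z)"
    by (rule isLub_mult_left[OF t_lub]) (use z a in auto)
  then have lub: "isLub UNIV (range (\<lambda>n. a * ?t n)) (a * z)" by (simp add: image_image)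
  have "mono (\<lambda>n. a * ?t n)" using mono_trunc[of z] a by (auto simp: mono_def intro: mult_left_mono)
  then have dir: "up_directed (range (\<lambda>n. a * ?t n))" by (rule up_directed_range_mono)
  have "T (a * ?t n) \<le> a * T z" for n
    unfolding avg(2) by (intro mult_left_mono T_mono tL z a) simp
  with avg t0 a have *: "a * z \<in> L \<and> T (a * z) \<le> a * T z"
    by (intro T_levi[OF _ _ dir lub]) auto
  then show "a * z \<in> L" ..
  \<comment> \<open>Order continuity along the truncations is read off from \<open>T_levi\<close>:
    any bound on the expectations of the truncations bounds T z.\<close>
  have "isLub UNIV (range (\<lambda>n. T (?t n))) (T z)"
    unfolding isLub_UNIV_iff
  proof (intro conjI allI impI)
    show "\<forall>d\<in>range (\<lambda>n. T (?t n)). d \<le> T z" using z tL by (auto intro: T_mono)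
    fix b assume "\<forall>d\<in>range (\<lambda>n. T (?t n)). d \<le> b"
    then have "z \<in> L \<and> T z \<le> b" using tL t0
      by (intro T_levi[OF _ _ up_directed_range_mono[OF mono_trunc] t_lub, of b]) blast+
    then show "T z \<le> b" ..
  qed
  then have "isLub UNIV ((*) a ` range (\<lambda>n. T (?t n))) (a * T z)"
    by (rule isLub_mult_left) (use z a tL t0 in \<open>auto intro!: T_nonneg\<close>)
  moreover have "a * T (?t n) \<le> T (a * z)" for n
    unfolding avg(2)[symmetric] using a t0 *  by (intro T_mono avg mult_left_mono) auto
  ultimately have "a * T z \<le> T (a * z)" by (auto simp: isLub_UNIV_iff)
  with * show "T (a * z) = a * T z" by simp
qed

lemma averaging:
  assumes a: "a \<in> A" and z: "z \<in> L"
  shows "a * z \<in> L" "T (a * z) = a * T z"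
proof -
  let ?a = "- nprt a" and ?z = "- nprt z"
  have A: "pprt a \<in> A" "0 \<le> pprt a" "?a \<in> A" "0 \<le> ?a" using a by (auto simp: A_pprt A_nprt)
  have Z: "pprt z \<in> L" "0 \<le> pprt z" "?z \<in> L" "0 \<le> ?z" using z by (auto simp: L_pprt L_nprt L_minus)
  have aeq: "a = pprt a - ?a" and zeq: "z = pprt z - ?z" by (simp_all add: pprt_minus_nprt)
  have av: "a * y \<in> L" "T (a * y) = a * T y" if "y \<in> L" "0 \<le> y" for y
  proof -
    have "a * y = pprt a * y - ?a * y" using aeq left_diff_distrib by metis
    moreover have "a * T y = pprt a * T y - ?a * T y" using aeq left_diff_distrib by metis
    ultimately show "a * y \<in> L" "T (a * y) = a * T y"
      using averaging_nonneg[OF A(1,2) that] averaging_nonneg[OF A(3,4) that]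
      by (simp_all add: L_diff T_diff del: mult_minus_left)
  qed
  have *: "a * z = a * pprt z - a * ?z" using zeq right_diff_distrib by metis
  then show "a * z \<in> L" by (simp add: av Z L_diff del: mult_minus_right)
  have "T z = T (pprt z) - T ?z" using T_diff[OF Z(1,3)] zeq by simp
  then show "T (a * z) = a * T z"
    unfolding * by (simp add: av Z T_diff right_diff_distrib del: mult_minus_right)
qed

lemma A_mult: "a \<in> A \<Longrightarrow> b \<in> A \<Longrightarrow> a * b \<in> A"
  using averaging[of a b] by (auto simp: A_iff)

subsection \<open>Square roots\<close>

text \<open>Directedness upgrades the bound on squares to a bound on all products c * d; the
  supremum is then taken in one factor after the other.\<close>

lemma square_le_if_isLub:
  assumes D: "up_directed D" "\<And>d. d \<in> D \<Longrightarrow> 0 \<le> (d::'u)" and le: "\<And>d. d \<in> D \<Longrightarrow> d * d \<le> f"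
    and r: "isLub UNIV D r"
  shows "r * r \<le> f"
proof -
  obtain d0 where "d0 \<in> D" using D(1) by (auto simp: up_directed_def)
  then have r0: "0 \<le> r" using D r by (meson isLub_UNIV_iff order.trans)
  have prod: "c * d \<le> f" if "c \<in> D" "d \<in> D" for c d
  proof -
    obtain w where w: "w \<in> D" "c \<le> w" "d \<le> w" using D(1) \<open>c \<in> D\<close> \<open>d \<in> D\<close>
      by (auto simp: up_directed_def)
    then have "c * d \<le> w * w" using D that by (intro mult_mono) auto
    also have "\<dots> \<le> f" using le w by auto
    finally show ?thesis .
  qed
  have "c * r \<le> f" if "c \<in> D" for c
    using isLub_mult_left[OF r D(2) r0 D(2)[OF that]] prod[OF that] by (auto simp: isLub_UNIV_iff)
  then have "r * c \<le> f" if "c \<in> D" for c using that mult_commute by metis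
  with isLub_mult_left[OF r D(2) r0 r0] show ?thesis by (auto simp: isLub_UNIV_iff)
qed

text \<open>With w = \<open>sup a b\<close>, the elements w - a and w - b are disjoint and stay so
  after multiplication by the nonnegative w + a and w + b. Thus w w - a a and w w - b b have infimum
  0, while w w - f lies below both.\<close>

lemma square_sup_le:
  assumes "0 \<le> a" "0 \<le> b" "a * a \<le> f" "b * b \<le> (f::'u)"
  shows "sup a b * sup a b \<le> f"
proof -
  let ?w = "sup a b"
  have inf0: "inf (?w - a) (?w - b) = 0"
  proof -
    have "inf (?w - a) (?w - b) = ?w + inf (- a) (- b)" by (simp add: add_inf_distrib_left del: neg_sup_eq_inf)
    then show ?thesis by (simp flip: neg_sup_eq_inf)
  qed
  have w: "0 \<le> ?w + a" "0 \<le> ?w + b" using assms by (simp_all add: le_supI1)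
  have "inf ((?w - a) * (?w + a)) (?w - b) = 0"
    using inf0 w f_algebra unfolding f_algebra_with_unit_def by blast
  then have "inf (?w - b) ((?w - a) * (?w + a)) = 0" by (simp add: inf_commute)
  then have "inf ((?w - b) * (?w + b)) ((?w - a) * (?w + a)) = 0"
    using w f_algebra unfolding f_algebra_with_unit_def by blast
  moreover have "(?w - c) * (?w + c) = ?w * ?w - c * c" for c
    by (simp add: algebra_simps mult_commute)
  ultimately have 0: "inf (?w * ?w - b * b) (?w * ?w - a * a) = 0" by simp
  have "?w * ?w - f \<le> inf (?w * ?w - b * b) (?w * ?w - a * a)"
    using assms by (intro inf_greatest diff_left_mono) auto
  then show ?thesis unfolding 0 by simp
qed

lemma ex_sqrt_bounded:
  assumes f: "f \<in> A" "0 \<le> f" "f \<le> real m *\<^sub>R e" and m: "0 < m"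
  shows "\<exists>r\<in>A. 0 \<le> r \<and> r * r = f"
proof -
  define D where "D = {a \<in> A. 0 \<le> a \<and> a * a \<le> f}"
  have "0 \<in> D" using f A_zero by (simp add: D_def)
  have dir: "up_directed D"
    unfolding up_directed_def
  proof (intro conjI ballI)
    show "D \<noteq> {}" using \<open>0 \<in> D\<close> by auto
    fix a b assume "a \<in> D" "b \<in> D"
    then have "sup a b \<in> D" unfolding D_def by (auto intro!: A_sup square_sup_le simp: le_supI1)
    then show "\<exists>c\<in>D. a \<le> c \<and> b \<le> c" by (intro bexI[of _ "sup a b"]) auto
  qed
  \<comment> \<open>As m is a positive integer, m \<le> m * m; hence m e, whose square is m * m e,
    bounds D.\<close>
  have me: "real m *\<^sub>R e \<le> (real m * real m) *\<^sub>R e" using m by (intro scaleR_right_mono) auto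
  have D_le: "a \<le> real m *\<^sub>R e" if "a \<in> D" for a
  proof (rule square_le_imp_le)
    show "0 \<le> a" "0 \<le> real m *\<^sub>R e" using that by (auto simp: D_def)
    have "a * a \<le> f" using that by (simp add: D_def)
    also note f(3)
    also note me
    finally show "a * a \<le> real m *\<^sub>R e * real m *\<^sub>R e" by simp
  qed
  obtain r where r: "isLub UNIV D r" using ex_isLub[of D] D_le \<open>0 \<in> D\<close> by blast
  have rA: "r \<in> A" using dir r by (intro A_isLub[of D]) (auto simp: D_def)
  have r0: "0 \<le> r" using r \<open>0 \<in> D\<close> by (auto simp: isLub_UNIV_iff)
  have rm: "r \<le> real m *\<^sub>R e" using r D_le by (auto simp: isLub_UNIV_iff)
  have rr: "r * r \<le> f" by (rule square_le_if_isLub[OF dir _ _ r]) (auto simp: D_def)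
  define g where "g = f - r * r"
  \<comment> \<open>If the gap g were nonzero, r + c g would be a larger member of D. In its square
    the mixed term is at most 2 c m g, because r \<le> m e, and the last term at most c m g, because
    g \<le> m e and c \<le> 1; c is chosen so that together they give exactly g.\<close>
  define c where "c = 1 / (3 * real m)"
  have c: "0 < c" "3 * real m * c = 1" using m by (auto simp: c_def)
  have g: "0 \<le> g" "g \<le> real m *\<^sub>R e" "g \<in> A"
  proof -
    show "0 \<le> g" using rr by (simp add: g_def)
    show "g \<in> A" unfolding g_def by (intro A_diff f A_mult rA)
    have "g \<le> f" unfolding g_def using square_nonneg by simp
    then show "g \<le> real m *\<^sub>R e" using f by order
  qed
  have "r + c *\<^sub>R g \<in> D"
  proof -
    have rg: "r * g \<le> real m *\<^sub>R g" using mult_right_mono[OF rm g(1)] by simp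
    have gg: "g * g \<le> real m *\<^sub>R g" using mult_right_mono[OF g(2) g(1)] by simp
    have "c * c \<le> c" using c m by (simp add: c_def field_simps)
    have "(r + c *\<^sub>R g) * (r + c *\<^sub>R g) = r * r + (2 * c) *\<^sub>R (r * g) + (c * c) *\<^sub>R (g * g)"
      by (simp add: algebra_simps mult_commute[of g r] flip: scaleR_left.add)
    also have "\<dots> \<le> r * r + (2 * c) *\<^sub>R (real m *\<^sub>R g) + c *\<^sub>R (real m *\<^sub>R g)"
      using c m \<open>c * c \<le> c\<close> by (intro add_mono scaleR_left_mono rg scaleR_mono gg square_nonneg) auto
    also have "\<dots> = r * r + (3 * real m * c) *\<^sub>R g" by (simp add: algebra_simps flip: scaleR_left.add)
    also have "\<dots> = f" unfolding c(2) by (simp add: g_def)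
    finally show ?thesis
      using rA g r0 c by (auto simp: D_def scaleR_nonneg_nonneg intro!: A_add A_scaleR)
  qed
  then have "r + c *\<^sub>R g \<le> r" using r by (auto simp: isLub_UNIV_iff)
  then have "c *\<^sub>R g \<le> 0" by simp
  then have "(1 / c) *\<^sub>R c *\<^sub>R g \<le> (1 / c) *\<^sub>R 0" using c by (intro scaleR_left_mono) auto
  then have "g \<le> 0" using c by simp
  with g have "r * r = f" by (simp add: g_def)
  with rA r0 show ?thesis by blast
qed

lemma ex_sqrt:
  assumes f: "f \<in> A" "0 \<le> f"
  shows "\<exists>r\<in>A. 0 \<le> r \<and> r * r = f"
proof -
  \<comment> \<open>\<open>Suc n\<close> keeps the truncation level positive, as
    \<open>ex_sqrt_bounded\<close> requires.\<close>
  let ?t = "\<lambda>n::nat. inf f (real (Suc n) *\<^sub>R e)"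
  have "\<exists>r\<in>A. 0 \<le> r \<and> r * r = ?t n" for n
    using f by (intro ex_sqrt_bounded[of _ "Suc n"] A_inf A_scaleR A_unit) (auto intro: scaleR_nonneg_nonneg)
  then obtain q where q: "\<And>n. q n \<in> A" "\<And>n. 0 \<le> q n" "\<And>n. q n * q n = ?t n" by metis
  have qmono: "mono q"
  proof (rule monoI, rule square_le_imp_le[OF q(2) q(2)])
    fix m n :: nat assume "m \<le> n"
    then show "q m * q m \<le> q n * q n" unfolding q by (intro inf_mono scaleR_right_mono) auto
  qed
  \<comment> \<open>The root of f may exceed f where f is below e; e + f is a safe bound because f
    \<le> (e + f) * (e + f).\<close>
  have "q n \<le> e + f" for n
  proof (rule square_le_imp_le)
    have "q n * q n \<le> f" unfolding q by simp
    also have "f \<le> f + (e + f + f * f)" using f square_nonneg[of f] by simp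
    also have "\<dots> = (e + f) * (e + f)" by (simp add: algebra_simps)
    finally show "q n * q n \<le> (e + f) * (e + f)" .
  qed (use f q in auto)
  then obtain r where r: "isLub UNIV (range q) r" using ex_isLub[of "range q" "e + f"] by auto
  have dir: "up_directed (range q)" using qmono by (rule up_directed_range_mono)
  have rA: "r \<in> A" by (rule A_isLub[OF _ _ dir r]) (use q in auto)
  have qr: "q n \<le> r" for n using r by (auto simp: isLub_UNIV_iff)
  have r0: "0 \<le> r" using q(2) qr order.trans by blast
  have "r * r \<le> f" by (rule square_le_if_isLub[OF dir _ _ r]) (use q in auto)
  moreover have "f \<le> r * r"
  proof -
    have "inf f (real n *\<^sub>R e) \<le> r * r" for n
    proof -
      have "inf f (real n *\<^sub>R e) \<le> ?t n" by (intro inf_mono scaleR_right_mono) auto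
      also have "\<dots> \<le> r * r" unfolding q(3)[symmetric] using q qr r0 by (intro mult_mono) auto
      finally show ?thesis .
    qed
    then show ?thesis using isLub_trunc[OF f(2)] by (auto simp: isLub_UNIV_iff)
  qed
  ultimately show ?thesis using rA r0 by force
qed

subsection \<open>The module \<open>L\<^sup>2\<close>\<close>

definition H where "H = {x \<in> L. x * x \<in> L}"

lemma H_L: "x \<in> H \<Longrightarrow> x \<in> L" and H_square: "x \<in> H \<Longrightarrow> x * x \<in> L"
  by (simp_all add: H_def)

lemma H_solid:
  assumes "x \<in> H" "\<bar>y\<bar> \<le> \<bar>x\<bar>" shows "y \<in> H"
proof -
  have "y \<in> L" using assms H_L L_solid by blast
  have "y * y \<le> x * x"
    using mult_mono[OF assms(2) assms(2)] by (simp add: abs_mult_abs)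
  then have "y * y \<in> L" using assms by - (rule L_between[of "x * x"], auto simp: H_square square_nonneg)
  with \<open>y \<in> L\<close> show ?thesis by (simp add: H_def)
qed

lemma square_add_le: "(x + y) * (x + y) \<le> 2 *\<^sub>R (x * x) + 2 *\<^sub>R (y * (y::'u))"
proof -
  have "0 \<le> (x - y) * (x - y)" by (rule square_nonneg)
  then show ?thesis by (simp add: algebra_simps scaleR_2)
qed

lemma H_add:
  assumes "x \<in> H" "y \<in> H" shows "x + y \<in> H"
proof -
  have "(x + y) * (x + y) \<in> L"
    using assms by (blast intro: L_between[OF _ square_nonneg square_add_le] L_add L_scaleR H_square)
  then show ?thesis using assms by (simp add: H_def L_add)
qed

lemma H_mult:
  assumes "a \<in> A" "x \<in> H" shows "a * x \<in> H"
proof -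
  have "(a * x) * (a * x) = (a * a) * (x * x)" by (metis mult.assoc mult_commute)
  then have "(a * x) * (a * x) \<in> L" using assms by (simp add: averaging A_mult H_square)
  then show ?thesis using assms by (simp add: H_def averaging)
qed

lemma scaled_unit_mult: "(c *\<^sub>R e) * x = c *\<^sub>R x"
  by simp

lemma H_scaleR: "x \<in> H \<Longrightarrow> c *\<^sub>R x \<in> H"
  using H_mult[OF A_scaleR[OF A_unit]] by (metis scaled_unit_mult)

lemma H_zero: "0 \<in> H"
  using L_scaleR[OF L_unit, of 0] by (simp add: H_def)

lemma H_minus: "x \<in> H \<Longrightarrow> - x \<in> H"
  using H_scaleR[of x "-1"] by simp

lemma H_diff: "x \<in> H \<Longrightarrow> y \<in> H \<Longrightarrow> x - y \<in> H"
  using H_add[of x "- y"] H_minus by simp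

lemma H_abs: "x \<in> H \<Longrightarrow> \<bar>x\<bar> \<in> H"
  by (rule H_solid[of x]) auto

lemma H_pprt: "x \<in> H \<Longrightarrow> pprt x \<in> H" and H_nprt: "x \<in> H \<Longrightarrow> - nprt x \<in> H"
  by (rule H_solid[of x]; simp add: pprt_le_abs)+

definition nrm where "nrm x = (THE r. r \<in> A \<and> 0 \<le> r \<and> r * r = T (x * x))"

lemma nrm:
  assumes "x \<in> H"
  shows "nrm x \<in> A" "0 \<le> nrm x" "nrm x * nrm x = T (x * x)"
proof -
  have "\<exists>r\<in>A. 0 \<le> r \<and> r * r = T (x * x)"
    using assms by (intro ex_sqrt) (auto intro!: H_square T_nonneg square_nonneg)
  then have "\<exists>!r. r \<in> A \<and> 0 \<le> r \<and> r * r = T (x * x)"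
    by (metis order.antisym order.refl square_le_imp_le)
  from theI'[OF this] show "nrm x \<in> A" "0 \<le> nrm x" "nrm x * nrm x = T (x * x)"
    unfolding nrm_def by auto
qed

text \<open>Removes the roots, so that strong boundedness becomes an inequality between values of T,
  to which monotonicity and additivity of T apply.\<close>

lemma nrm_le_iff:
  assumes "x \<in> H" "y \<in> H" "0 \<le> k"
  shows "nrm y \<le> k * nrm x \<longleftrightarrow> T (y * y) \<le> k * k * T (x * x)"
proof -
  have eq: "(k * nrm x) * (k * nrm x) = k * k * T (x * x)"
    by (metis mult.assoc mult_commute nrm(3)[OF assms(1)])
  have "0 \<le> nrm y" "0 \<le> k * nrm x" using assms nrm by auto
  then have "nrm y \<le> k * nrm x \<longleftrightarrow> nrm y * nrm y \<le> (k * nrm x) * (k * nrm x)"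
    by (meson mult_mono square_le_imp_le)
  then show ?thesis unfolding eq using nrm assms by simp
qed

end

section \<open>Operators on \<open>L\<^sup>2\<close>\<close>

context cond_exp_ideal
begin

lemma A_linearD:
  assumes "A_linear A H S"
  shows "x \<notin> H \<Longrightarrow> S x = 0" "x \<in> H \<Longrightarrow> S x \<in> H"
    "x \<in> H \<Longrightarrow> y \<in> H \<Longrightarrow> S (x + y) = S x + S y" "a \<in> A \<Longrightarrow> x \<in> H \<Longrightarrow> S (a * x) = a * S x"
  using assms by (auto simp: A_linear_def)

text \<open>Real scalars act as the elements \<open>c *\<^sub>R e\<close> of A, so A-homogeneity
  contains real homogeneity.\<close>

lemma A_linear_scaleR:
  assumes "A_linear A H S" "x \<in> H" shows "S (c *\<^sub>R x) = c *\<^sub>R S x"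
  using A_linearD(4)[OF assms(1) A_scaleR[OF A_unit] assms(2)] by (metis scaled_unit_mult)

lemma A_linear_zero: "A_linear A H S \<Longrightarrow> S 0 = 0"
  using A_linear_scaleR[of S 0 0] H_zero by simp

lemma A_linear_minus: "A_linear A H S \<Longrightarrow> x \<in> H \<Longrightarrow> S (- x) = - S x"
  using A_linear_scaleR[of S x "-1"] by simp

lemma A_linear_diff: "A_linear A H S \<Longrightarrow> x \<in> H \<Longrightarrow> y \<in> H \<Longrightarrow> S (x - y) = S x - S y"
  using A_linearD(3)[of S x "- y"] A_linear_minus H_minus by simp

lemma A_linear_zero_op: "A_linear A H (\<lambda>x. 0)"
  by (auto simp: A_linear_def H_zero)

lemma A_linear_add_op: "A_linear A H R \<Longrightarrow> A_linear A H S \<Longrightarrow> A_linear A H (\<lambda>x. R x + S x)"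
  by (auto simp: A_linear_def H_add algebra_simps image_subset_iff)

lemma A_linear_diff_op: "A_linear A H R \<Longrightarrow> A_linear A H S \<Longrightarrow> A_linear A H (\<lambda>x. R x - S x)"
  by (auto simp: A_linear_def H_diff algebra_simps image_subset_iff)

lemma A_linear_scaleR_op: "A_linear A H S \<Longrightarrow> A_linear A H (\<lambda>x. c *\<^sub>R S x)"
  by (auto simp: A_linear_def H_scaleR algebra_simps image_subset_iff)

lemma op_positive_mono:
  assumes "A_linear A H S" "op_positive H S" "x \<in> H" "y \<in> H" "x \<le> y"
  shows "S x \<le> S y"
  using assms A_linear_diff[of S y x] H_diff[of y x] by (auto simp: op_positive_def)

lemma op_positive_abs:
  assumes "A_linear A H S" "op_positive H S" "x \<in> H"
  shows "\<bar>S x\<bar> \<le> S \<bar>x\<bar>"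
  using op_positive_mono[of S x "\<bar>x\<bar>"] op_positive_mono[of S "- x" "\<bar>x\<bar>"] assms
  by (intro abs_leI) (auto simp: H_abs H_minus A_linear_minus abs_ge_self abs_ge_minus_self)

lemma op_le_iff: "op_le H R S \<longleftrightarrow> (\<forall>x\<in>H. 0 \<le> x \<longrightarrow> R x \<le> S x)"
  by (simp add: op_le_def op_positive_def)

lemma diff_positive_in_Lb:
  assumes "A_linear A H P" "op_positive H P" "A_linear A H Q" "op_positive H Q"
  shows "(\<lambda>x. P x - Q x) \<in> Lb A H"
  unfolding Lb_def
proof (intro CollectI conjI ballI)
  show "A_linear A H (\<lambda>x. P x - Q x)" using assms by (simp add: A_linear_diff_op)
  fix a b assume "a \<in> H" "b \<in> H"
  show "\<exists>c\<in>H. \<exists>d\<in>H. (\<lambda>x. P x - Q x) ` ({a..b} \<inter> H) \<subseteq> {c..d}"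
  proof (rule bexI[of _ "P a - Q b"], rule bexI[of _ "P b - Q a"], rule subsetI)
    fix y assume "y \<in> (\<lambda>x. P x - Q x) ` ({a..b} \<inter> H)"
    then obtain x where x: "x \<in> H" "a \<le> x" "x \<le> b" "y = P x - Q x" by auto
    then have "P a \<le> P x" "P x \<le> P b" "Q a \<le> Q x" "Q x \<le> Q b"
      using \<open>a \<in> H\<close> \<open>b \<in> H\<close> assms by (meson op_positive_mono)+
    then show "y \<in> {P a - Q b..P b - Q a}" unfolding x(4) by (simp add: diff_mono)
  qed (use \<open>a \<in> H\<close> \<open>b \<in> H\<close> assms in \<open>auto intro: H_diff A_linearD(2)\<close>)
qed

lemma positive_in_Lb: "A_linear A H P \<Longrightarrow> op_positive H P \<Longrightarrow> P \<in> Lb A H"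
  using diff_positive_in_Lb[of P "\<lambda>x. 0"] by (simp add: A_linear_zero_op op_positive_def)

subsection \<open>The Riesz--Kantorovich modulus\<close>

text \<open>Order boundedness on [- x, x] bounds the set by an element of H. Its supremum in the
  whole space then lies in H by solidity and is also the supremum relative to H.\<close>

lemma rk_sup_isLub:
  assumes R: "R \<in> Lb A H" and x: "x \<in> H" "0 \<le> x"
  shows "rk_sup H R x \<in> H" "isLub UNIV {\<bar>R u\<bar> | u. u \<in> H \<and> \<bar>u\<bar> \<le> x} (rk_sup H R x)"
proof -
  let ?D = "{\<bar>R u\<bar> | u. u \<in> H \<and> \<bar>u\<bar> \<le> x}"
  have lin: "A_linear A H R" using R by (simp add: Lb_def)
  obtain c d where cd: "c \<in> H" "d \<in> H" "R ` ({- x..x} \<inter> H) \<subseteq> {c..d}"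
    using R x H_minus unfolding Lb_def by blast
  have bound: "y \<le> \<bar>c\<bar> + \<bar>d\<bar>" if "y \<in> ?D" for y
  proof -
    obtain u where u: "u \<in> H" "\<bar>u\<bar> \<le> x" "y = \<bar>R u\<bar>" using \<open>y \<in> ?D\<close> by auto
    then have "u \<in> {- x..x}" using abs_le_D2[of u x] by (auto dest: abs_le_D1 simp: minus_le_iff)
    with u cd(3) have "R u \<in> {c..d}" by blast
    then have *: "c \<le> R u" "R u \<le> d" by auto
    have "R u \<le> \<bar>c\<bar> + \<bar>d\<bar>"
      using order.trans[OF *(2) abs_ge_self[of d]] by (simp add: add_increasing)
    moreover have "- R u \<le> \<bar>c\<bar> + \<bar>d\<bar>"
      using order.trans[OF le_imp_neg_le[OF *(1)] abs_ge_minus_self[of c]] by (simp add: add_increasing2)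
    ultimately show ?thesis unfolding u(3) by (rule abs_leI)
  qed
  have "0 \<in> ?D" using A_linear_zero[OF lin] x H_zero by (auto intro!: exI[of _ 0])
  with bound obtain s where s: "isLub UNIV ?D s" using ex_isLub[of ?D] by blast
  have "0 \<le> s" "s \<le> \<bar>c\<bar> + \<bar>d\<bar>" using s \<open>0 \<in> ?D\<close> bound unfolding isLub_UNIV_iff by blast+
  then have sH: "s \<in> H" using H_add[OF H_abs H_abs] cd by - (rule H_solid[of "\<bar>c\<bar> + \<bar>d\<bar>"], auto)
  have "isLub H ?D s" using s sH
    by (auto simp: isLub_def leastP_def isUb_def setle_def setge_def)
  then have "rk_sup H R x = s" unfolding rk_sup_def by (intro the_equality) (auto intro: isLub_eqI)
  with s sH show "rk_sup H R x \<in> H" "isLub UNIV ?D (rk_sup H R x)" by auto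
qed

lemma rk_sup_upper:
  assumes "R \<in> Lb A H" "x \<in> H" "u \<in> H" "\<bar>u\<bar> \<le> x"
  shows "\<bar>R u\<bar> \<le> rk_sup H R x"
proof -
  have "0 \<le> x" using assms(4) abs_ge_zero order.trans by blast
  then show ?thesis using rk_sup_isLub(2)[OF assms(1,2)] assms unfolding isLub_UNIV_iff by blast
qed

lemma rk_sup_least:
  assumes "R \<in> Lb A H" "x \<in> H" "0 \<le> x" "\<And>u. u \<in> H \<Longrightarrow> \<bar>u\<bar> \<le> x \<Longrightarrow> \<bar>R u\<bar> \<le> b"
  shows "rk_sup H R x \<le> b"
  using rk_sup_isLub(2)[OF assms(1-3)] assms(4) unfolding isLub_UNIV_iff by blast

lemma rk_sup_nonneg: "R \<in> Lb A H \<Longrightarrow> x \<in> H \<Longrightarrow> 0 \<le> x \<Longrightarrow> 0 \<le> rk_sup H R x"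
  using rk_sup_upper[of R x 0] H_zero by (metis abs_ge_zero abs_zero order.trans)

lemma rk_sup_mono:
  assumes "R \<in> Lb A H" "x \<in> H" "y \<in> H" "0 \<le> x" "x \<le> y"
  shows "rk_sup H R x \<le> rk_sup H R y"
  by (rule rk_sup_least) (use assms in \<open>auto intro!: rk_sup_upper\<close>)

lemma rk_sup_add:
  assumes R: "R \<in> Lb A H" and xy: "x \<in> H" "y \<in> H" "0 \<le> x" "0 \<le> y"
  shows "rk_sup H R (x + y) = rk_sup H R x + rk_sup H R y"
proof (rule order.antisym)
  have lin: "A_linear A H R" using R by (simp add: Lb_def)
  show "rk_sup H R (x + y) \<le> rk_sup H R x + rk_sup H R y"
  proof (rule rk_sup_least[OF R])
    fix u assume u: "u \<in> H" "\<bar>u\<bar> \<le> x + y"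
    \<comment> \<open>This is u clipped to [- x, x]; the remainder u - v stays in [- y, y], a Riesz
      decomposition for elements without a fixed sign.\<close>
    define v where "v = sup (inf u x) (- x)"
    have u': "u \<le> x + y" "- u \<le> x + y" using u(2) by (auto dest: abs_le_D1 abs_le_D2)
    have v: "\<bar>v\<bar> \<le> x"
    proof (rule abs_leI)
      show "v \<le> x" using xy by (auto simp: v_def intro: order.trans[of _ 0])
      have "- x \<le> v" by (simp add: v_def)
      then show "- v \<le> x" by (simp add: minus_le_iff)
    qed
    have uv: "\<bar>u - v\<bar> \<le> y"
    proof (rule abs_leI)
      have "u - y \<le> inf u x" using u' xy by (simp add: algebra_simps)
      then have "u - y \<le> v" by (simp add: v_def le_supI1)
      then show "u - v \<le> y" by (simp add: algebra_simps)
      have "inf u x \<le> u + y" using xy by (simp add: le_infI1)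
      moreover have "- x \<le> u + y" using u'(2) by (metis add.commute diff_le_eq minus_le_iff uminus_add_conv_diff minus_diff_eq diff_minus_eq_add)
      ultimately have "v \<le> u + y" by (simp add: v_def)
      then show "- (u - v) \<le> y" by (simp add: algebra_simps)
    qed
    have vH: "v \<in> H" "u - v \<in> H"
      using v uv xy by (auto intro: H_solid[OF xy(1)] H_solid[OF xy(2)])
    have "R u = R v + R (u - v)" using A_linearD(3)[OF lin vH] by simp
    then have "\<bar>R u\<bar> \<le> \<bar>R v\<bar> + \<bar>R (u - v)\<bar>" by (simp add: abs_triangle_ineq)
    also have "\<dots> \<le> rk_sup H R x + rk_sup H R y"
      using R xy v uv vH by (intro add_mono rk_sup_upper) auto
    finally show "\<bar>R u\<bar> \<le> rk_sup H R x + rk_sup H R y" .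
  qed (use xy H_add in auto)
  \<comment> \<open>Choosing the better sign: \<open>abs_add_abs_eq_sup\<close> writes the sum as
    the supremum of \<bar>R (u + v)\<bar> and \<bar>R (u - v)\<bar>, and both arguments are
    dominated by x + y.\<close>
  have "\<bar>R u\<bar> + \<bar>R v\<bar> \<le> rk_sup H R (x + y)" if "u \<in> H" "v \<in> H" "\<bar>u\<bar> \<le> x" "\<bar>v\<bar> \<le> y" for u v
  proof -
    have "\<bar>u + v\<bar> \<le> x + y" "\<bar>u - v\<bar> \<le> x + y"
      using that by (meson abs_triangle_ineq abs_triangle_ineq4 add_mono order.trans)+
    then have "\<bar>R (u + v)\<bar> \<le> rk_sup H R (x + y)" "\<bar>R (u - v)\<bar> \<le> rk_sup H R (x + y)"
      using R xy that by (auto intro!: rk_sup_upper H_add H_diff)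
    then show ?thesis using that by (simp add: abs_add_abs_eq_sup A_linear_diff[OF lin] A_linearD(3)[OF lin])
  qed
  then have "\<bar>R u\<bar> \<le> rk_sup H R (x + y) - \<bar>R v\<bar>" if "u \<in> H" "v \<in> H" "\<bar>u\<bar> \<le> x" "\<bar>v\<bar> \<le> y" for u v
    using that by (simp add: le_diff_eq)
  then have "rk_sup H R x \<le> rk_sup H R (x + y) - \<bar>R v\<bar>" if "v \<in> H" "\<bar>v\<bar> \<le> y" for v
    using that by (intro rk_sup_least[OF R xy(1,3)]) auto
  then have "\<bar>R v\<bar> \<le> rk_sup H R (x + y) - rk_sup H R x" if "v \<in> H" "\<bar>v\<bar> \<le> y" for v
    using that by (simp add: algebra_simps)
  then have "rk_sup H R y \<le> rk_sup H R (x + y) - rk_sup H R x"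
    by (intro rk_sup_least[OF R xy(2,4)]) auto
  then show "rk_sup H R x + rk_sup H R y \<le> rk_sup H R (x + y)" by (simp add: algebra_simps)
qed

lemma rk_sup_zero: "R \<in> Lb A H \<Longrightarrow> rk_sup H R 0 = 0"
  using rk_sup_add[of R 0 0] H_zero by simp

lemma rk_sup_nat:
  assumes R: "R \<in> Lb A H" and x: "x \<in> H" "0 \<le> x"
  shows "rk_sup H R (real n *\<^sub>R x) = real n *\<^sub>R rk_sup H R x"
proof (induction n)
  case (Suc n)
  have "real (Suc n) *\<^sub>R x = x + real n *\<^sub>R x" by (simp add: algebra_simps)
  then show ?case
    using Suc rk_sup_add[OF R x(1) H_scaleR[OF x(1)] x(2), of "real n"] x
    by (simp add: algebra_simps scaleR_nonneg_nonneg)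
qed (simp add: rk_sup_zero[OF R])

text \<open>Multiplication by a maps [- x, x] into [- a x, a x] and preserves suprema. The image
  need not be all of [- a x, a x] when a is not invertible, so the opposite inequality calls for a
  different argument.\<close>

lemma rk_sup_mult_ge:
  assumes R: "R \<in> Lb A H" and x: "x \<in> H" "0 \<le> x" and a: "a \<in> A" "0 \<le> a"
  shows "a * rk_sup H R x \<le> rk_sup H R (a * x)"
proof -
  let ?D = "{\<bar>R u\<bar> | u. u \<in> H \<and> \<bar>u\<bar> \<le> x}"
  have lin: "A_linear A H R" using R by (simp add: Lb_def)
  have "a * \<bar>R u\<bar> \<le> rk_sup H R (a * x)" if u: "u \<in> H" "\<bar>u\<bar> \<le> x" for u
  proof -
    have "a * \<bar>R u\<bar> = \<bar>R (a * u)\<bar>"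
      using A_linearD(4)[OF lin a(1) u(1)] abs_mult_nonneg[OF a(2)] by simp
    also have "\<dots> \<le> rk_sup H R (a * x)"
    proof (rule rk_sup_upper[OF R])
      have "\<bar>a * u\<bar> \<le> \<bar>a\<bar> * \<bar>u\<bar>" by (rule abs_le_mult)
      also have "\<dots> \<le> a * x" using a u by (simp add: mult_left_mono)
      finally show "\<bar>a * u\<bar> \<le> a * x" .
    qed (use a u x H_mult in auto)
    finally show ?thesis .
  qed
  then have le: "\<forall>d\<in>(*) a ` ?D. d \<le> rk_sup H R (a * x)" by blast
  have "isLub UNIV ((*) a ` ?D) (a * rk_sup H R x)"
    by (rule isLub_mult_left[OF rk_sup_isLub(2)[OF R x] _ rk_sup_nonneg[OF R x] a(2)]) auto
  with le show ?thesis unfolding isLub_UNIV_iff by blast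
qed

lemma rk_sup_mult_bounded:
  assumes R: "R \<in> Lb A H" and x: "x \<in> H" "0 \<le> x" and a: "a \<in> A" "0 \<le> a" "a \<le> real n *\<^sub>R e"
  shows "rk_sup H R (a * x) = a * rk_sup H R x"
proof (rule order.antisym)
  let ?b = "real n *\<^sub>R e - a"
    \<comment> \<open>\<open>rk_sup_mult_ge\<close> for \<open>a\<close> and for \<open>?b\<close> add up to an equality, so both are equalities.\<close>
  have b: "?b \<in> A" "0 \<le> ?b" using a by (auto intro: A_diff A_scaleR A_unit)
  have "rk_sup H R (a * x) + ?b * rk_sup H R x \<le> rk_sup H R (a * x) + rk_sup H R (?b * x)"
    by (intro add_left_mono rk_sup_mult_ge R x b)
  also have "\<dots> = rk_sup H R (a * x + ?b * x)"
    by (rule rk_sup_add[OF R, symmetric]) (use a b x H_mult in auto)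
  also have "a * x + ?b * x = real n *\<^sub>R x" by (simp add: algebra_simps)
  also have "rk_sup H R (real n *\<^sub>R x) = real n *\<^sub>R rk_sup H R x" by (rule rk_sup_nat[OF R x])
  finally show "rk_sup H R (a * x) \<le> a * rk_sup H R x" by (simp add: algebra_simps)
  show "a * rk_sup H R x \<le> rk_sup H R (a * x)" by (rule rk_sup_mult_ge[OF R x a(1,2)])
qed

lemma rk_sup_mult:
  assumes R: "R \<in> Lb A H" and x: "x \<in> H" "0 \<le> x" and a: "a \<in> A" "0 \<le> a"
  shows "rk_sup H R (a * x) = a * rk_sup H R x"
proof (rule order.antisym)
  show "a * rk_sup H R x \<le> rk_sup H R (a * x)" by (rule rk_sup_mult_ge[OF R x a])
  show "rk_sup H R (a * x) \<le> a * rk_sup H R x"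
  proof (rule le_if_le_add_scaled[of _ _ "rk_sup H R (a * a * x)"])
    fix n :: nat assume n: "0 < n"
    let ?t = "inf a (real n *\<^sub>R e)" and ?p = "pprt (a - real n *\<^sub>R e)"
      and ?y = "(1 / real n) *\<^sub>R (a * a * x)"
    have t: "?t \<in> A" "0 \<le> ?t" "?t \<le> real n *\<^sub>R e" using a by (auto intro: A_inf A_scaleR A_unit)
    have p: "?p \<in> A" "0 \<le> ?p" using a by (auto intro: A_pprt A_diff A_scaleR A_unit)
    have y: "?y \<in> H" "0 \<le> ?y" using a x
      by (auto intro!: H_scaleR H_mult A_mult scaleR_nonneg_nonneg)
    have "?p * x \<le> ?y" using mult_right_mono[OF pprt_diff_unit_le[OF n, of a] x(2)] by simp
    have "a * x = ?t * x + ?p * x" using trunc_decomp[of a "real n *\<^sub>R e"] by (metis distrib_right)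
    then have "rk_sup H R (a * x) = rk_sup H R (?t * x) + rk_sup H R (?p * x)"
      using rk_sup_add[OF R, of "?t * x" "?p * x"] x t p H_mult by simp
    also have "\<dots> \<le> a * rk_sup H R x + rk_sup H R ?y"
    proof (intro add_mono)
      show "rk_sup H R (?t * x) \<le> a * rk_sup H R x"
        unfolding rk_sup_mult_bounded[OF R x t]
        by (intro mult_right_mono rk_sup_nonneg R x) simp
      show "rk_sup H R (?p * x) \<le> rk_sup H R ?y"
        by (rule rk_sup_mono[OF R]) (use \<open>?p * x \<le> ?y\<close> x p y H_mult in auto)
    qed
    \<comment> \<open>Homogeneity for the factor 1 / n comes from \<open>rk_sup_nat\<close> applied
      to \<open>?y\<close>, since n times \<open>?y\<close> is a * a * x.\<close>
    also have "rk_sup H R ?y = (1 / real n) *\<^sub>R rk_sup H R (a * a * x)"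
      using rk_sup_nat[OF R y, of n] n by simp
    finally show "rk_sup H R (a * x) \<le> a * rk_sup H R x + (1 / real n) *\<^sub>R rk_sup H R (a * a * x)" .
  qed
qed

text \<open>Additivity of \<open>rk_sup\<close> makes the value independent of how an element is
  written as a difference of nonnegative ones, so linearity can be checked on any convenient
  decomposition.\<close>

lemma rk_modulus_diff:
  assumes R: "R \<in> Lb A H" and xy: "x \<in> H" "y \<in> H" "0 \<le> x" "0 \<le> y"
  shows "rk_modulus H R (x - y) = rk_sup H R x - rk_sup H R y"
proof -
  let ?z = "x - y"
  have "pprt ?z + y = x + (- nprt ?z)"
    using pprt_minus_nprt[of ?z] by (simp add: algebra_simps)
  then have "rk_sup H R (pprt ?z + y) = rk_sup H R (x + (- nprt ?z))" by (rule arg_cong)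
  then have "rk_sup H R (pprt ?z) + rk_sup H R y = rk_sup H R x + rk_sup H R (- nprt ?z)"
    using rk_sup_add[OF R, of "pprt ?z" y] rk_sup_add[OF R, of x "- nprt ?z"]
      H_pprt[of ?z] H_nprt[of ?z] xy H_diff by simp
  then show ?thesis using xy H_diff by (simp add: rk_modulus_def algebra_simps)
qed

lemma rk_modulus_nonneg_eq:
  assumes "R \<in> Lb A H" "x \<in> H" "0 \<le> x" shows "rk_modulus H R x = rk_sup H R x"
  using rk_modulus_diff[of R x 0] assms H_zero rk_sup_zero by simp

lemma H_decomp:
  assumes "x \<in> H"
  obtains p n where "p \<in> H" "n \<in> H" "0 \<le> p" "0 \<le> n" "x = p - n"
  using H_pprt[OF assms] H_nprt[OF assms] by (auto intro!: that[of "pprt x" "- nprt x"] simp: pprt_minus_nprt)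

lemma rk_modulus_A_linear:
  assumes R: "R \<in> Lb A H"
  shows "A_linear A H (rk_modulus H R)"
  unfolding A_linear_def
proof (intro conjI allI impI ballI)
  fix x y assume x: "x \<in> H" and y: "y \<in> H"
  obtain p n where pn: "p \<in> H" "n \<in> H" "0 \<le> p" "0 \<le> n" "x = p - n" by (rule H_decomp[OF x])
  obtain p' n' where pn': "p' \<in> H" "n' \<in> H" "0 \<le> p'" "0 \<le> n'" "y = p' - n'" by (rule H_decomp[OF y])
  have "x + y = (p + p') - (n + n')" using pn pn' by simp
  then have "rk_modulus H R (x + y) = rk_sup H R (p + p') - rk_sup H R (n + n')"
    using rk_modulus_diff[OF R, of "p + p'" "n + n'"] pn(1-4) pn'(1-4) H_add by simp
  then show "rk_modulus H R (x + y) = rk_modulus H R x + rk_modulus H R y"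
    unfolding pn(5) pn'(5) using pn(1-4) pn'(1-4)
    by (simp add: rk_modulus_diff[OF R] rk_sup_add[OF R])
next
  fix a x assume a: "a \<in> A" and x: "x \<in> H"
  obtain p n where pn: "p \<in> H" "n \<in> H" "0 \<le> p" "0 \<le> n" "x = p - n" by (rule H_decomp[OF x])
  define b c where "b = pprt a" and "c = - nprt a"
  have bc: "b \<in> A" "c \<in> A" "0 \<le> b" "0 \<le> c" "a = b - c"
    using A_pprt[OF a] A_nprt[OF a] by (simp_all only: b_def c_def) (simp_all add: pprt_minus_nprt)
  \<comment> \<open>The four products are grouped by sign, giving a difference of two nonnegative
    elements.\<close>
  have "a * x = (b * p + c * n) - (b * n + c * p)"
    unfolding pn bc by (simp add: algebra_simps)
  then have "rk_modulus H R (a * x) = rk_sup H R (b * p + c * n) - rk_sup H R (b * n + c * p)"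
    using rk_modulus_diff[OF R, of "b * p + c * n" "b * n + c * p"] pn(1-4) bc(1-4) H_add H_mult by simp
  also have "\<dots> = (b - c) * (rk_sup H R p - rk_sup H R n)"
    using pn(1-4) bc(1-4) H_mult by (simp add: rk_sup_add[OF R] rk_sup_mult[OF R] algebra_simps)
  finally show "rk_modulus H R (a * x) = a * rk_modulus H R x"
    using pn bc rk_modulus_diff[OF R pn(1-4)] by simp
next
  show "rk_modulus H R ` H \<subseteq> H"
    using rk_sup_isLub(1)[OF R] H_pprt H_nprt H_diff by (auto simp: rk_modulus_def)
qed (simp add: rk_modulus_def)

lemma rk_modulus_positive: "R \<in> Lb A H \<Longrightarrow> op_positive H (rk_modulus H R)"
  by (simp add: op_positive_def rk_modulus_nonneg_eq rk_sup_nonneg)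

lemma abs_le_rk_modulus:
  assumes "R \<in> Lb A H" "x \<in> H" "0 \<le> x" shows "\<bar>R x\<bar> \<le> rk_modulus H R x"
  using assms rk_sup_upper[of R x x] by (simp add: rk_modulus_nonneg_eq)

text \<open>Dominating R and - R forces N to be positive, and then \<bar>R u\<bar> \<le> N
  \<bar>u\<bar> by splitting u into its positive and negative part.\<close>

lemma rk_modulus_least:
  assumes R: "R \<in> Lb A H" and N: "A_linear A H N" "op_le H R N" "op_le H (\<lambda>x. - R x) N"
  shows "op_le H (rk_modulus H R) N"
  unfolding op_le_iff
proof (intro ballI impI)
  have lin: "A_linear A H R" using R by (simp add: Lb_def)
  fix x assume x: "x \<in> H" "0 \<le> x"
  have le: "\<bar>R v\<bar> \<le> N v" if "v \<in> H" "0 \<le> v" for v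
    using N that by (auto simp: op_le_iff intro: abs_leI)
  then have pos: "op_positive H N" using abs_ge_zero order.trans unfolding op_positive_def by blast
  have "rk_sup H R x \<le> N x"
  proof (rule rk_sup_least[OF R x])
    fix u assume u: "u \<in> H" "\<bar>u\<bar> \<le> x"
    have "R u = R (pprt u) - R (- nprt u)"
      using A_linear_diff[OF lin H_pprt[OF u(1)] H_nprt[OF u(1)]] by (simp add: pprt_minus_nprt)
    then have "\<bar>R u\<bar> \<le> \<bar>R (pprt u)\<bar> + \<bar>R (- nprt u)\<bar>" by (simp add: abs_triangle_ineq4)
    also have "\<dots> \<le> N (pprt u) + N (- nprt u)"
      by (intro add_mono le) (auto simp: u H_pprt H_nprt)
    also have "\<dots> = N \<bar>u\<bar>"
      using A_linearD(3)[OF N(1) H_pprt[OF u(1)] H_nprt[OF u(1)]] by (simp add: abs_prts)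
    also have "\<dots> \<le> N x" using u x by (intro op_positive_mono[OF N(1) pos]) (auto simp: H_abs)
    finally show "\<bar>R u\<bar> \<le> N x" .
  qed
  then show "rk_modulus H R x \<le> N x" using x R by (simp add: rk_modulus_nonneg_eq)
qed

lemma A_linear_eqI:
  assumes "A_linear A H R" "A_linear A H S" "op_le H R S" "op_le H S R"
  shows "R = S"
proof
  fix x
  have eq: "R y = S y" if "y \<in> H" "0 \<le> y" for y
    using assms(3,4) that by (auto simp: op_le_iff intro: order.antisym)
  show "R x = S x"
  proof (cases "x \<in> H")
    case True
    have "R (pprt x - (- nprt x)) = S (pprt x - (- nprt x))"
      using eq A_linear_diff[OF assms(1) H_pprt[OF True] H_nprt[OF True]]
        A_linear_diff[OF assms(2) H_pprt[OF True] H_nprt[OF True]] H_pprt[OF True] H_nprt[OF True] by simp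
    then show ?thesis by (simp add: pprt_minus_nprt)
  qed (simp add: A_linearD(1)[OF assms(1)] A_linearD(1)[OF assms(2)])
qed

text \<open>Identifies the abstract lattice modulus, in which the ideal property is phrased, with
  the Riesz--Kantorovich formula; uniqueness is antisymmetry of the operator order.\<close>

lemma op_modulus_eq_rk_modulus:
  assumes R: "R \<in> Lb A H"
  shows "op_modulus A H R = rk_modulus H R"
  unfolding op_modulus_def
proof (rule the_equality)
  have "op_le H R (rk_modulus H R)" "op_le H (\<lambda>x. - R x) (rk_modulus H R)"
    using abs_le_rk_modulus[OF R] by (auto simp: op_le_iff dest: abs_le_D1 abs_le_D2)
  moreover have "rk_modulus H R \<in> Lb A H"
    by (intro positive_in_Lb rk_modulus_A_linear rk_modulus_positive R)
  moreover have "op_le H (rk_modulus H R) N"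
    if "N \<in> Lb A H" "op_le H R N" "op_le H (\<lambda>x. - R x) N" for N
    using that by (intro rk_modulus_least[OF R]) (auto simp: Lb_def)
  ultimately show *: "rk_modulus H R \<in> Lb A H \<and> op_le H R (rk_modulus H R) \<and>
    op_le H (\<lambda>x. - R x) (rk_modulus H R) \<and>
    (\<forall>N\<in>Lb A H. op_le H R N \<and> op_le H (\<lambda>x. - R x) N \<longrightarrow> op_le H (rk_modulus H R) N)"
    by blast
  fix M assume "M \<in> Lb A H \<and> op_le H R M \<and> op_le H (\<lambda>x. - R x) M \<and>
    (\<forall>N\<in>Lb A H. op_le H R N \<and> op_le H (\<lambda>x. - R x) N \<longrightarrow> op_le H M N)"
  with * show "M = rk_modulus H R" by (intro A_linear_eqI) (auto simp: Lb_def)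
qed

subsection \<open>Strongly bounded positive operators\<close>

definition pos_bounded where
  "pos_bounded = {S. A_linear A H S \<and> op_positive H S \<and>
     (\<exists>k\<in>A. 0 \<le> k \<and> (\<forall>x\<in>H. T (S x * S x) \<le> k * k * T (x * x)))}"

lemma pos_bounded_dominated:
  assumes Q: "A_linear A H Q" "op_positive H Q" "op_le H Q P" and P: "P \<in> pos_bounded"
  shows "Q \<in> pos_bounded"
proof -
  obtain k where k: "k \<in> A" "0 \<le> k" "\<forall>x\<in>H. T (P x * P x) \<le> k * k * T (x * x)"
    and P': "A_linear A H P" using P by (auto simp: pos_bounded_def)
  have "T (Q x * Q x) \<le> k * k * T (x * x)" if x: "x \<in> H" for x
  proof -
    have PH: "P \<bar>x\<bar> \<in> H" "Q x \<in> H"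
      using A_linearD(2)[OF P' H_abs[OF x]] A_linearD(2)[OF Q(1) x] by auto
    have "\<bar>Q x\<bar> \<le> Q \<bar>x\<bar>" using Q x by (intro op_positive_abs)
    also have "\<dots> \<le> P \<bar>x\<bar>" using Q x by (auto simp: op_le_iff H_abs)
    finally have le: "\<bar>Q x\<bar> \<le> P \<bar>x\<bar>" .
    have "\<bar>Q x\<bar> * \<bar>Q x\<bar> \<le> P \<bar>x\<bar> * P \<bar>x\<bar>"
      using le by (intro mult_mono) (auto intro: order.trans[OF abs_ge_zero])
    then have "T (Q x * Q x) \<le> T (P \<bar>x\<bar> * P \<bar>x\<bar>)"
      unfolding abs_mult_abs using PH by (intro T_mono H_square)
    also have "\<dots> \<le> k * k * T (\<bar>x\<bar> * \<bar>x\<bar>)" using k x H_abs by blast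
    finally show ?thesis by (simp only: abs_mult_abs)
  qed
  with k Q show ?thesis unfolding pos_bounded_def by blast
qed

lemma pos_bounded_zero: "(\<lambda>x. 0) \<in> pos_bounded"
  unfolding pos_bounded_def
proof (intro CollectI conjI bexI[of _ 0])
  show "\<forall>x\<in>H. T (0 * 0) \<le> 0 * 0 * T (x * x)" using T_scaleR[OF L_unit, of 0] by simp
qed (simp_all add: A_linear_zero_op op_positive_def A_zero)

lemma pos_bounded_scaleR:
  assumes S: "S \<in> pos_bounded" and c: "0 \<le> c"
  shows "(\<lambda>x. c *\<^sub>R S x) \<in> pos_bounded"
proof -
  obtain k where k: "k \<in> A" "0 \<le> k" "\<forall>x\<in>H. T (S x * S x) \<le> k * k * T (x * x)"
    and S': "A_linear A H S" "op_positive H S" using S by (auto simp: pos_bounded_def)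
  have "T ((c *\<^sub>R S x) * (c *\<^sub>R S x)) \<le> (c *\<^sub>R k) * (c *\<^sub>R k) * T (x * x)" if x: "x \<in> H" for x
  proof -
    have "S x * S x \<in> L" using S' x by (auto intro: H_square A_linearD)
    then have "T ((c *\<^sub>R S x) * (c *\<^sub>R S x)) = (c * c) *\<^sub>R T (S x * S x)" by (simp add: T_scaleR)
    also have "\<dots> \<le> (c * c) *\<^sub>R (k * k * T (x * x))" using k x by (intro scaleR_left_mono) auto
    finally show ?thesis by simp
  qed
  moreover have "c *\<^sub>R k \<in> A" "0 \<le> c *\<^sub>R k" using k c by (auto intro: A_scaleR scaleR_nonneg_nonneg)
  moreover have "op_positive H (\<lambda>x. c *\<^sub>R S x)"
    using S' c by (auto simp: op_positive_def intro: scaleR_nonneg_nonneg)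
  ultimately show ?thesis using S' A_linear_scaleR_op unfolding pos_bounded_def by blast
qed

lemma pos_bounded_add:
  assumes "R \<in> pos_bounded" and "S \<in> pos_bounded"
  shows "(\<lambda>x. R x + S x) \<in> pos_bounded"
proof -
  obtain k where k: "k \<in> A" "0 \<le> k" "\<forall>x\<in>H. T (R x * R x) \<le> k * k * T (x * x)"
    and R: "A_linear A H R" "op_positive H R" using assms by (auto simp: pos_bounded_def)
  obtain l where l: "l \<in> A" "0 \<le> l" "\<forall>x\<in>H. T (S x * S x) \<le> l * l * T (x * x)"
    and S: "A_linear A H S" "op_positive H S" using assms by (auto simp: pos_bounded_def)
  \<comment> \<open>Since (R x + S x) squared is at most twice the sum of the squares, the square of
    \<open>?k\<close> has to dominate 2 k k + 2 l l; 2 (k + l) does so without extracting a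
    root.\<close>
  let ?k = "2 *\<^sub>R (k + l)"
  have "T ((R x + S x) * (R x + S x)) \<le> ?k * ?k * T (x * x)" if x: "x \<in> H" for x
  proof -
    have L: "R x * R x \<in> L" "S x * S x \<in> L" "(R x + S x) * (R x + S x) \<in> L"
      using A_linearD(2)[OF R(1) x] A_linearD(2)[OF S(1) x] by (auto intro!: H_square H_add)
    have N: "0 \<le> T (x * x)" using x by (intro T_nonneg H_square square_nonneg)
    have "T ((R x + S x) * (R x + S x)) \<le> T (2 *\<^sub>R (R x * R x) + 2 *\<^sub>R (S x * S x))"
      by (intro T_mono L L_add L_scaleR square_add_le)
    also have "\<dots> = 2 *\<^sub>R T (R x * R x) + 2 *\<^sub>R T (S x * S x)" using L by (simp add: T_add T_scaleR L_scaleR)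
    also have "\<dots> \<le> 2 *\<^sub>R (k * k * T (x * x)) + 2 *\<^sub>R (l * l * T (x * x))"
      using k l x by (intro add_mono scaleR_left_mono) auto
    also have "\<dots> = (2 *\<^sub>R (k * k) + 2 *\<^sub>R (l * l)) * T (x * x)" by (simp add: algebra_simps)
    also have "\<dots> \<le> ?k * ?k * T (x * x)"
    proof (rule mult_right_mono[OF _ N])
      have four: "4 *\<^sub>R z = 2 *\<^sub>R z + 2 *\<^sub>R z" for z :: 'u by (simp flip: scaleR_left.add)
      have "0 \<le> k * k" "0 \<le> l * l" "0 \<le> k * l" "0 \<le> l * k" using k l by auto
      then have "0 \<le> 2 *\<^sub>R (k * k) + 2 *\<^sub>R (l * l) + 4 *\<^sub>R (k * l) + 4 *\<^sub>R (l * k)"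
        by (intro add_nonneg_nonneg scaleR_nonneg_nonneg) auto
      also have "\<dots> = ?k * ?k - (2 *\<^sub>R (k * k) + 2 *\<^sub>R (l * l))"
        by (simp add: algebra_simps four)
      finally show "2 *\<^sub>R (k * k) + 2 *\<^sub>R (l * l) \<le> ?k * ?k" by simp
    qed
    finally show ?thesis .
  qed
  moreover have "?k \<in> A" "0 \<le> ?k" using k l by (auto intro: A_scaleR A_add scaleR_nonneg_nonneg)
  moreover have "op_positive H (\<lambda>x. R x + S x)" using R S by (auto simp: op_positive_def)
  ultimately show ?thesis using R S A_linear_add_op unfolding pos_bounded_def by blast
qed

definition regular where
  "regular = {(\<lambda>x. P x - Q x) | P Q. P \<in> pos_bounded \<and> Q \<in> pos_bounded}"

lemma regularI: "P \<in> pos_bounded \<Longrightarrow> Q \<in> pos_bounded \<Longrightarrow> (\<lambda>x. P x - Q x) \<in> regular"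
  unfolding regular_def by blast

lemma regular_subset_Lb: "regular \<subseteq> Lb A H"
  unfolding regular_def pos_bounded_def by (auto intro: diff_positive_in_Lb)

lemma regular_positive: "{S \<in> regular. op_le H (\<lambda>x. 0) S} = pos_bounded"
proof (intro equalityI subsetI)
  fix S assume "S \<in> {S \<in> regular. op_le H (\<lambda>x. 0) S}"
  then obtain P Q where S: "S = (\<lambda>x. P x - Q x)" "P \<in> pos_bounded" "Q \<in> pos_bounded"
    "op_positive H S" by (auto simp: regular_def op_le_def)
  \<comment> \<open>As Q is positive, P - Q \<le> P, so a positive difference is dominated by
    P.\<close>
  then show "S \<in> pos_bounded"
    by (intro pos_bounded_dominated[of S P]) (auto simp: pos_bounded_def op_le_iff op_positive_def A_linear_diff_op)
next
  fix S assume S: "S \<in> pos_bounded"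
  then have "(\<lambda>x. S x - 0) \<in> regular" by (intro regularI pos_bounded_zero)
  with S show "S \<in> {S \<in> regular. op_le H (\<lambda>x. 0) S}" by (simp add: op_le_def pos_bounded_def)
qed

lemma regular_if_rk_modulus_le:
  assumes R: "R \<in> Lb A H" and S: "S \<in> regular" and le: "op_le H (rk_modulus H R) (rk_modulus H S)"
  shows "R \<in> regular"
proof -
  obtain P Q where PQ: "S = (\<lambda>x. P x - Q x)" "P \<in> pos_bounded" "Q \<in> pos_bounded"
    using S by (auto simp: regular_def)
  then have PQ': "A_linear A H P" "op_positive H P" "A_linear A H Q" "op_positive H Q"
    by (auto simp: pos_bounded_def)
  have S_Lb: "S \<in> Lb A H" unfolding PQ(1) by (intro diff_positive_in_Lb PQ')
  have lin: "A_linear A H R" using R by (simp add: Lb_def)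
  let ?M = "rk_modulus H R"
  have M: "A_linear A H ?M" "op_positive H ?M"
    using R by (simp_all add: rk_modulus_A_linear rk_modulus_positive)
  have "op_le H (rk_modulus H S) (\<lambda>x. P x + Q x)"
  proof (rule rk_modulus_least[OF S_Lb])
    show "op_le H S (\<lambda>x. P x + Q x)" "op_le H (\<lambda>x. - S x) (\<lambda>x. P x + Q x)"
      using PQ' unfolding PQ(1) op_le_def op_positive_def by auto
  qed (intro A_linear_add_op PQ')
  then have "op_le H ?M (\<lambda>x. P x + Q x)" using le unfolding op_le_iff by (meson order.trans)
  then have Mb: "?M \<in> pos_bounded"
    using M PQ by (auto intro: pos_bounded_dominated pos_bounded_add)
  have RM: "R x \<le> ?M x" "- R x \<le> ?M x" if "x \<in> H" "0 \<le> x" for x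
    using abs_le_rk_modulus[OF R that] by (auto dest: abs_le_D1 abs_le_D2)
  have "(\<lambda>x. ?M x - R x) \<in> pos_bounded"
  proof (rule pos_bounded_dominated[OF _ _ _ pos_bounded_add[OF Mb Mb]])
    show "op_le H (\<lambda>x. ?M x - R x) (\<lambda>x. ?M x + ?M x)"
      unfolding op_le_iff using add_left_mono[OF RM(2)] by simp
  qed (use RM M lin in \<open>auto simp: A_linear_diff_op op_positive_def\<close>)
  \<comment> \<open>R is the difference of its modulus and of the modulus minus R, both now known to
    be positive and strongly bounded.\<close>
  with Mb have "(\<lambda>x. ?M x - (?M x - R x)) \<in> regular" by (rule regularI)
  then show ?thesis by simp
qed

lemma order_ideal_regular: "order_ideal_Lb A H regular"
  unfolding order_ideal_Lb_def
proof (intro conjI ballI allI impI)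
  show "regular \<subseteq> Lb A H" by (rule regular_subset_Lb)
  show "(\<lambda>x. 0) \<in> regular" using regular_positive pos_bounded_zero by blast
next
  fix R S assume "R \<in> regular" "S \<in> regular"
  then obtain P Q P' Q' where R: "R = (\<lambda>x. P x - Q x)" and S: "S = (\<lambda>x. P' x - Q' x)"
    and *: "P \<in> pos_bounded" "Q \<in> pos_bounded" "P' \<in> pos_bounded" "Q' \<in> pos_bounded"
    unfolding regular_def by blast
  have "(\<lambda>x. (P x + P' x) - (Q x + Q' x)) \<in> regular"
    by (intro regularI pos_bounded_add *)
  then show "(\<lambda>x. R x + S x) \<in> regular" unfolding R S by (simp only: add_diff_add)
next
  fix c and S assume "S \<in> regular"
  then obtain P Q where PQ: "S = (\<lambda>x. P x - Q x)" "P \<in> pos_bounded" "Q \<in> pos_bounded"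
    by (auto simp: regular_def)
  show "(\<lambda>x. c *\<^sub>R S x) \<in> regular"
  proof (cases "0 \<le> c")
    case True
    then have "(\<lambda>x. c *\<^sub>R P x - c *\<^sub>R Q x) \<in> regular"
      by (intro regularI pos_bounded_scaleR PQ)
    then show ?thesis by (simp add: PQ scaleR_right_diff_distrib)
  next
    case False
    then have "(\<lambda>x. (- c) *\<^sub>R Q x - (- c) *\<^sub>R P x) \<in> regular"
      by (intro regularI pos_bounded_scaleR PQ) auto
    then show ?thesis by (simp add: PQ scaleR_right_diff_distrib)
  qed
next
  fix R S assume R: "R \<in> Lb A H" and S: "S \<in> regular"
    and le: "op_le H (op_modulus A H R) (op_modulus A H S)"
  have "S \<in> Lb A H" using S regular_subset_Lb by blast
  then show "R \<in> regular"
    using regular_if_rk_modulus_le[OF R S] le by (simp only: op_modulus_eq_rk_modulus[OF R] op_modulus_eq_rk_modulus)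
qed

end

section \<open>The natural domain of \<open>T\<close>\<close>

locale riesz_cond_exp = unital_f_algebra e
  for e :: "'u::{ordered_real_vector, real_algebra, lattice_ring}" +
  fixes E :: "'u set" and T :: "'u \<Rightarrow> 'u"
  assumes universal_completion: "is_universal_completion E"
    and complete_E: "dedekind_complete E"
    and unit_E: "e \<in> E"
    and cond_exp: "conditional_expectation E T"
    and T_e: "T e = e"
    and strict: "strictly_positive E T"
begin

lemma subspace_E: "subspace E"
  and E_sup: "x \<in> E \<Longrightarrow> y \<in> E \<Longrightarrow> sup x y \<in> E" and E_inf: "x \<in> E \<Longrightarrow> y \<in> E \<Longrightarrow> inf x y \<in> E"
  using universal_completion by (auto simp: is_universal_completion_def riesz_subspace_def)

lemmas E_add = subspace_add[OF subspace_E] and E_diff = subspace_diff[OF subspace_E]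
  and E_scaleR = subspace_scale[OF subspace_E] and E_zero = subspace_0[OF subspace_E]

lemma dense_E:
  assumes "0 < x" obtains y where "y \<in> E" "0 < y" "y \<le> x"
  using universal_completion assms unfolding is_universal_completion_def order_dense_def by blast

lemma E_T: "x \<in> E \<Longrightarrow> T x \<in> E"
  using cond_exp by (auto simp: conditional_expectation_def)

lemma ET_add: "x \<in> E \<Longrightarrow> y \<in> E \<Longrightarrow> T (x + y) = T x + T y"
  using cond_exp by (simp add: conditional_expectation_def)

lemma ET_scaleR: "x \<in> E \<Longrightarrow> T (c *\<^sub>R x) = c *\<^sub>R T x"
  using cond_exp by (simp add: conditional_expectation_def)

lemma ET_nonneg: "x \<in> E \<Longrightarrow> 0 \<le> x \<Longrightarrow> 0 \<le> T x"
  using cond_exp by (simp add: conditional_expectation_def)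

lemma ET_cont: "D \<subseteq> E \<Longrightarrow> down_directed D \<Longrightarrow> isGlb E D 0 \<Longrightarrow> isGlb E (T ` D) 0"
  using cond_exp by (simp add: conditional_expectation_def)

lemma ET_idem: "x \<in> E \<Longrightarrow> T (T x) = T x"
  using cond_exp by (simp add: conditional_expectation_def)

lemma ET_diff: "x \<in> E \<Longrightarrow> y \<in> E \<Longrightarrow> T (x - y) = T x - T y"
  using ET_add[of "x - y" y] E_diff by (simp add: algebra_simps)

lemma ET_zero: "T 0 = 0"
  using ET_scaleR[OF E_zero, of 0] by simp

lemma ET_mono: "x \<in> E \<Longrightarrow> y \<in> E \<Longrightarrow> x \<le> y \<Longrightarrow> T x \<le> T y"
  using ET_nonneg[of "y - x"] ET_diff[of y x] E_diff[of y x] by simp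

text \<open>A standard net for x: the natural cone and the extension of T allow an arbitrary net in
  E increasing to x, and all of them are compared with this largest one.\<close>

definition below where "below x = {d \<in> E. 0 \<le> d \<and> d \<le> x}"

lemma zero_below: "0 \<le> x \<Longrightarrow> 0 \<in> below x"
  by (simp add: below_def E_zero)

text \<open>If an upper bound b failed to dominate x, order density would give v > 0 in E under the
  positive part of x - b. Each n v below x is then below \<open>inf x b\<close>, so (n + 1) v is
  still below x, against the Archimedean property.\<close>

lemma isLub_below:
  assumes "0 \<le> x" shows "isLub UNIV (below x) x"
  unfolding isLub_UNIV_iff
proof (intro conjI allI impI)
  show "\<forall>d\<in>below x. d \<le> x" by (simp add: below_def)
  fix b assume b: "\<forall>d\<in>below x. d \<le> b"
  show "x \<le> b"
  proof (rule ccontr)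
    assume "\<not> x \<le> b"
    then have "0 < pprt (x - b)" using le_zero_iff_zero_pprt[of "x - b"] by (simp add: order_less_le)
    then obtain v where v: "v \<in> E" "0 < v" "v \<le> pprt (x - b)" by (rule dense_E)
    then have vx: "inf x b + v \<le> x" using diff_inf_eq_pprt[of x b] by (metis add.commute le_diff_eq)
    have "real n *\<^sub>R v \<in> below x" for n
    proof (induction n)
      case (Suc n)
      then have n: "real n *\<^sub>R v \<in> E" "0 \<le> real n *\<^sub>R v" "real n *\<^sub>R v \<le> inf x b"
        using b by (auto simp: below_def)
      have "real (Suc n) *\<^sub>R v = real n *\<^sub>R v + v" by (simp add: algebra_simps)
      also have "\<dots> \<le> inf x b + v" using n by (intro add_right_mono)
      also note vx
      finally show ?case using v by (auto simp: below_def E_scaleR intro: scaleR_nonneg_nonneg)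
    qed (simp add: zero_below assms)
    then have "real n *\<^sub>R v \<le> x" for n by (simp add: below_def)
    from archimedean[OF this] v show False by simp
  qed
qed

text \<open>Dedekind completeness gives \<open>below x\<close> a supremum s within E. If s exceeded
  x, order density would allow s to be lowered inside E; hence x = s.\<close>

lemma E_ideal:
  assumes "0 \<le> x" "x \<le> y" "y \<in> E" shows "x \<in> E"
proof -
  have "isUb E (below x) y" using assms by (auto simp: isUb_def setle_def below_def)
  moreover have "below x \<subseteq> E" "below x \<noteq> {}" using zero_below[OF assms(1)] by (auto simp: below_def)
  ultimately obtain s where s: "isLub E (below x) s" using complete_E unfolding dedekind_complete_def by blast
  then have sE: "s \<in> E" "\<And>d. d \<in> below x \<Longrightarrow> d \<le> s" by (auto dest: isLubD1a isLubD2)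
  then have xs: "x \<le> s" using isLub_below[OF assms(1)] by (simp add: isLub_UNIV_iff)
  have "s = x"
  proof (rule ccontr)
    assume "s \<noteq> x"
    with xs have "0 < s - x" by (simp add: order_less_le)
    then obtain v where v: "v \<in> E" "0 < v" "v \<le> s - x" by (rule dense_E)
    then have "x \<le> s - v" by (simp add: le_diff_eq add.commute)
    then have "isUb E (below x) (s - v)" using sE v
      by (auto simp: isUb_def setle_def below_def E_diff intro: order.trans)
    from isLub_le_isUb[OF s this] v show False by simp
  qed
  with sE show ?thesis by simp
qed

lemma T_le_if_T_inf_le:
  assumes D: "up_directed D" "isLub UNIV D f" "\<And>d'. d' \<in> D \<Longrightarrow> 0 \<le> d'"
    and d: "d \<in> below f" and b: "\<And>d'. d' \<in> D \<Longrightarrow> T (inf d d') \<le> b"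
  shows "T d \<le> b"
proof -
  let ?D = "(\<lambda>d'. d - inf d d') ` D" \<comment> \<open>decreases to \<open>0\<close>, so the order continuity of \<open>T\<close> applies\<close>
  have dE: "d \<in> E" "0 \<le> d" "d \<le> f" using d by (auto simp: below_def)
  have infE: "inf d d' \<in> E" if "d' \<in> D" for d'
    by (rule E_ideal[OF _ _ dE(1)]) (use D(3) dE that in auto)
  have sub: "?D \<subseteq> E" using E_diff[OF dE(1) infE] by blast
  have down: "down_directed ?D"
    unfolding down_directed_def
  proof (intro conjI ballI)
    show "?D \<noteq> {}" using D(1) by (simp add: up_directed_def)
    fix x y assume "x \<in> ?D" "y \<in> ?D"
    then obtain u v where uv: "u \<in> D" "v \<in> D" "x = d - inf d u" "y = d - inf d v" by blast
    then obtain w where "w \<in> D" "u \<le> w" "v \<le> w" using D(1) unfolding up_directed_def by blast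
    then show "\<exists>z\<in>?D. z \<le> x \<and> z \<le> y" unfolding uv
      by (intro bexI[of _ "d - inf d w"] conjI diff_left_mono inf_mono order.refl imageI)
  qed
  have "isGlb E ?D 0"
    unfolding isGlb_def greatestP_def
  proof (intro conjI)
    show "isLb E ?D 0" unfolding isLb_def setge_def
      using E_zero by (auto simp: le_diff_eq simp del: diff_inf_eq_sup)
    show "Collect (isLb E ?D) *<= 0"
      unfolding setle_def
    proof (intro ballI)
      fix w assume "w \<in> Collect (isLb E ?D)"
      then have w: "w \<le> d - inf d d'" if "d' \<in> D" for d'
        using that unfolding isLb_def setge_def by blast
      have "x \<le> d - w" if "x \<in> inf d ` D" for x
        using that w by (auto simp: algebra_simps simp del: diff_inf_eq_sup)
      then have "inf d f \<le> d - w" using isLub_inf[OF D(2), of d] by (simp add: isLub_UNIV_iff)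
      then show "w \<le> 0" using dE by (simp add: inf_absorb1)
    qed
  qed
  from ET_cont[OF sub down this] have glb: "isGlb E (T ` ?D) 0" .
  define c where "c = pprt (T d - b)"
  have c_le: "c \<le> T (d - inf d d')" if "d' \<in> D" for d'
  proof -
    have "T (d - inf d d') = T d - T (inf d d')" by (rule ET_diff[OF dE(1) infE[OF that]])
    moreover have "0 \<le> T (d - inf d d')"
      by (rule ET_nonneg[OF E_diff[OF dE(1) infE[OF that]]]) (simp add: le_diff_eq del: diff_inf_eq_sup)
    ultimately show ?thesis using b[OF that] unfolding c_def pprt_def
      by (intro le_supI) (simp_all add: diff_left_mono del: diff_inf_eq_sup)
  qed
  obtain d' where "d' \<in> D" using D(1) unfolding up_directed_def by blast
  \<comment> \<open>The infimum 0 is taken relative to E, so c can be compared with it only after c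
    is known to lie in E.\<close>
  then have "c \<in> E" using c_le[of d'] sub by (intro E_ideal[OF _ c_le E_T]) (auto simp: c_def)
  then have "isLb E (T ` ?D) c" using c_le by (auto simp: isLb_def setge_def simp del: diff_inf_eq_sup)
  from isGlb_le_isLb[OF glb this] show ?thesis
    by (simp add: c_def pprt_def)
qed

lemma up_directed_below:
  assumes "0 \<le> f" shows "up_directed (below f)"
  unfolding up_directed_def
proof (intro conjI ballI)
  show "below f \<noteq> {}" using zero_below[OF assms] by blast
  fix x y assume "x \<in> below f" "y \<in> below f"
  then show "\<exists>z\<in>below f. x \<le> z \<and> y \<le> z"
    by (intro bexI[of _ "sup x y"]) (auto simp: below_def E_sup le_supI1)
qed

lemma increases_to_below: "0 \<le> f \<Longrightarrow> increases_to E (below f) f"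
  by (simp add: increases_to_def up_directed_below isLub_below) (simp add: below_def subset_iff)

lemma increases_to_subset: "increases_to E D f \<Longrightarrow> D \<subseteq> below f"
  by (auto simp: increases_to_def below_def isLub_UNIV_iff)

text \<open>Any net increasing to f has the same bounds under T as all of \<open>below f\<close>;
  this makes the extension of T independent of the net.\<close>

lemma T_le_if_increases_to:
  assumes D: "increases_to E D f" and b: "\<And>d'. d' \<in> D \<Longrightarrow> T d' \<le> b" and d: "d \<in> below f"
  shows "T d \<le> b"
proof (rule T_le_if_T_inf_le[of D f])
  fix d' assume "d' \<in> D"
  then have d': "d' \<in> E" "T d' \<le> b" using D b by (auto simp: increases_to_def)
  have "d \<in> E" using d by (simp add: below_def)
  then have "T (inf d d') \<le> T d'" using d' by (intro ET_mono E_inf) auto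
  with d' show "T (inf d d') \<le> b" by simp
qed (use D d in \<open>auto simp: increases_to_def\<close>)

section \<open>The extension of T to the natural cone\<close>

abbreviation "C \<equiv> natural_cone E T"
abbreviation "Tc \<equiv> T_ext_cone E T"

lemma natural_cone_iff: "f \<in> C \<longleftrightarrow> 0 \<le> f \<and> (\<exists>b. \<forall>d\<in>below f. T d \<le> b)"
proof
  assume "f \<in> C"
  then obtain D b where "0 \<le> f" and D: "increases_to E D f" "\<And>d'. d' \<in> D \<Longrightarrow> T d' \<le> b"
    by (auto simp: natural_cone_def isUb_def setle_def)
  then show "0 \<le> f \<and> (\<exists>b. \<forall>d\<in>below f. T d \<le> b)" using T_le_if_increases_to[OF D] by blast
next
  assume "0 \<le> f \<and> (\<exists>b. \<forall>d\<in>below f. T d \<le> b)"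
  then show "f \<in> C" using increases_to_below[of f] by (auto simp: natural_cone_def isUb_def setle_def)
qed

lemma isLub_T_iff:
  assumes "increases_to E D f"
  shows "isLub UNIV (T ` D) s \<longleftrightarrow> isLub UNIV (T ` below f) s"
proof -
  have "(\<forall>d\<in>T ` D. d \<le> b) \<longleftrightarrow> (\<forall>d\<in>T ` below f. d \<le> b)" for b
    using T_le_if_increases_to[OF assms, of b] increases_to_subset[OF assms] by blast
  then show ?thesis unfolding isLub_UNIV_iff by presburger
qed

lemma Tc_eqI:
  assumes "increases_to E D f" "isLub UNIV (T ` D) s" shows "Tc f = s"
  unfolding T_ext_cone_def
proof (rule the_equality)
  show "\<exists>D. increases_to E D f \<and> isLub UNIV (T ` D) s" using assms by blast
  fix t assume "\<exists>D. increases_to E D f \<and> isLub UNIV (T ` D) t"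
  then show "t = s" using assms isLub_T_iff isLub_eqI by blast
qed

lemma isLub_Tc:
  assumes "f \<in> C" shows "isLub UNIV (T ` below f) (Tc f)"
proof -
  obtain b where f: "0 \<le> f" "\<forall>d\<in>below f. T d \<le> b" using assms by (auto simp: natural_cone_iff)
  then obtain s where s: "isLub UNIV (T ` below f) s"
    using ex_isLub[of "T ` below f" b] zero_below[of f] by blast
  from Tc_eqI[OF increases_to_below[OF f(1)] this] s show ?thesis by simp
qed

lemma Tc_upper: "f \<in> C \<Longrightarrow> d \<in> below f \<Longrightarrow> T d \<le> Tc f"
  using isLub_Tc[of f] by (auto simp: isLub_UNIV_iff)

lemma Tc_least: "f \<in> C \<Longrightarrow> (\<And>d. d \<in> below f \<Longrightarrow> T d \<le> b) \<Longrightarrow> Tc f \<le> b"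
  using isLub_Tc[of f] by (auto simp: isLub_UNIV_iff)

lemma C_nonneg: "f \<in> C \<Longrightarrow> 0 \<le> f"
  by (simp add: natural_cone_iff)

lemma Tc_nonneg: "f \<in> C \<Longrightarrow> 0 \<le> Tc f"
  using Tc_upper[of f 0] by (simp add: ET_zero zero_below C_nonneg)

lemma C_down: "f \<in> C \<Longrightarrow> 0 \<le> g \<Longrightarrow> g \<le> f \<Longrightarrow> g \<in> C"
  unfolding natural_cone_iff below_def by (auto intro: order.trans)

text \<open>Riesz decomposition: d is the sum of \<open>inf d f\<close>, which is below f, and a
  remainder below g; both parts lie in E because E is an ideal.\<close>

lemma below_add_le:
  assumes f: "f \<in> C" and g: "g \<in> C" and d: "d \<in> below (f + g)"
  shows "T d \<le> Tc f + Tc g"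
proof -
  have dE: "d \<in> E" "0 \<le> d" "d \<le> f + g" using d by (auto simp: below_def)
  let ?u = "inf d f"
  have "?u \<in> E" by (rule E_ideal[OF _ _ dE(1)]) (use dE C_nonneg[OF f] in auto)
  then have u: "?u \<in> below f" using dE C_nonneg[OF f] by (auto simp: below_def)
  have v0: "0 \<le> d - ?u" by (simp add: le_diff_eq del: diff_inf_eq_sup)
  have "d - g \<le> ?u" using dE C_nonneg[OF g] by (simp add: diff_le_eq add_increasing2)
  then have "d - ?u \<le> g" by (metis add.commute diff_le_eq)
  with v0 u dE have v: "d - ?u \<in> below g" by (auto simp: below_def E_diff simp del: diff_inf_eq_sup)
  have "T d = T ?u + T (d - ?u)" using u dE by (simp add: ET_diff below_def del: diff_inf_eq_sup)
  also have "\<dots> \<le> Tc f + Tc g" by (intro add_mono Tc_upper u v f g)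
  finally show ?thesis .
qed

lemma C_add: "f \<in> C \<Longrightarrow> g \<in> C \<Longrightarrow> f + g \<in> C"
  using below_add_le C_nonneg by (subst natural_cone_iff) (blast intro: add_nonneg_nonneg)

lemma Tc_add:
  assumes f: "f \<in> C" and g: "g \<in> C" shows "Tc (f + g) = Tc f + Tc g"
proof (rule order.antisym)
  show "Tc (f + g) \<le> Tc f + Tc g" using assms by (intro Tc_least C_add below_add_le)
  have "T d + T d' \<le> Tc (f + g)" if "d \<in> below f" "d' \<in> below g" for d d'
  proof -
    have "d + d' \<in> below (f + g)" using that by (auto simp: below_def E_add add_mono)
    from Tc_upper[OF C_add[OF f g] this] show ?thesis using that by (simp add: below_def ET_add)
  qed
  then have "T d \<le> Tc (f + g) - T d'" if "d \<in> below f" "d' \<in> below g" for d d'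
    using that by (simp add: le_diff_eq)
  then have "Tc f \<le> Tc (f + g) - T d'" if "d' \<in> below g" for d'
    using that by (intro Tc_least f)
  then have "T d' \<le> Tc (f + g) - Tc f" if "d' \<in> below g" for d'
    using that by (simp add: algebra_simps)
  then have "Tc g \<le> Tc (f + g) - Tc f" by (intro Tc_least g)
  then show "Tc f + Tc g \<le> Tc (f + g)" by (simp add: algebra_simps)
qed

lemma E_in_C: "x \<in> E \<Longrightarrow> 0 \<le> x \<Longrightarrow> x \<in> C"
  unfolding natural_cone_iff by (auto simp: below_def intro: ET_mono)

lemma Tc_E: "x \<in> E \<Longrightarrow> 0 \<le> x \<Longrightarrow> Tc x = T x"
  by (intro order.antisym Tc_least Tc_upper E_in_C) (auto simp: below_def intro: ET_mono)

lemma Tc_zero: "Tc 0 = 0"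
  using Tc_E[OF E_zero] ET_zero by simp

lemma C_zero: "0 \<in> C"
  by (simp add: E_in_C E_zero)

lemma scaleR_below:
  assumes "d \<in> below f" "0 \<le> c" shows "c *\<^sub>R d \<in> below (c *\<^sub>R f)"
  using assms by (auto simp: below_def E_scaleR scaleR_left_mono scaleR_nonneg_nonneg)

text \<open>Stated for every positive c, so that the reverse inequality follows by applying it to 1
  / c.\<close>

lemma Tc_scaleR_le:
  assumes f: "f \<in> C" and c: "0 < c"
  shows "c *\<^sub>R f \<in> C" "Tc (c *\<^sub>R f) \<le> c *\<^sub>R Tc f"
proof -
  have le: "T d \<le> c *\<^sub>R Tc f" if "d \<in> below (c *\<^sub>R f)" for d
  proof -
    have "(1 / c) *\<^sub>R d \<in> below ((1 / c) *\<^sub>R c *\<^sub>R f)" using that c by (intro scaleR_below) auto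
    then have d: "(1 / c) *\<^sub>R d \<in> below f" using c by simp
    have "T d = c *\<^sub>R T ((1 / c) *\<^sub>R d)" using c that by (simp add: ET_scaleR below_def)
    also have "\<dots> \<le> c *\<^sub>R Tc f" using c by (intro scaleR_left_mono Tc_upper f d) auto
    finally show ?thesis .
  qed
  then show "c *\<^sub>R f \<in> C" using c C_nonneg[OF f] unfolding natural_cone_iff[of "c *\<^sub>R f"]
    by (blast intro: scaleR_nonneg_nonneg order.strict_implies_order)
  then show "Tc (c *\<^sub>R f) \<le> c *\<^sub>R Tc f" using le by (rule Tc_least)
qed

lemma C_scaleR: "f \<in> C \<Longrightarrow> 0 \<le> c \<Longrightarrow> c *\<^sub>R f \<in> C"
  using Tc_scaleR_le(1)[of f c] C_zero by (cases "c = 0") auto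

lemma Tc_scaleR:
  assumes f: "f \<in> C" and c: "0 \<le> c"
  shows "Tc (c *\<^sub>R f) = c *\<^sub>R Tc f"
proof (cases "c = 0")
  case False
  with c have c: "0 < c" by simp
  have "Tc ((1 / c) *\<^sub>R c *\<^sub>R f) \<le> (1 / c) *\<^sub>R Tc (c *\<^sub>R f)"
    using c Tc_scaleR_le(1)[OF f c] by (intro Tc_scaleR_le(2)) simp_all
  then have "c *\<^sub>R Tc f \<le> c *\<^sub>R (1 / c) *\<^sub>R Tc (c *\<^sub>R f)"
    using c by (intro scaleR_left_mono) auto
  then show ?thesis using Tc_scaleR_le(2)[OF f c] c by simp
qed (simp add: Tc_zero)

text \<open>The image of \<open>below f\<close> under T is itself a directed set in E increasing to
  \<open>Tc f\<close>, and T fixes each of its members.\<close>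

lemma Tc_in_C:
  assumes f: "f \<in> C" shows "Tc f \<in> C" "Tc (Tc f) = Tc f"
proof -
  have dir: "up_directed (T ` below f)"
    unfolding up_directed_def
  proof (intro conjI ballI)
    show "T ` below f \<noteq> {}" using zero_below[OF C_nonneg[OF f]] by blast
    fix x y assume "x \<in> T ` below f" "y \<in> T ` below f"
    then obtain u v where uv: "u \<in> below f" "v \<in> below f" "x = T u" "y = T v" by blast
    then obtain w where "w \<in> below f" "u \<le> w" "v \<le> w"
      using up_directed_below[OF C_nonneg[OF f]] unfolding up_directed_def by blast
    then show "\<exists>z\<in>T ` below f. x \<le> z \<and> y \<le> z"
      using uv by (intro bexI[of _ "T w"]) (auto simp: below_def intro: ET_mono)
  qed
  have inc: "increases_to E (T ` below f) (Tc f)"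
    unfolding increases_to_def using dir isLub_Tc[OF f]
    by (auto simp: below_def E_T ET_nonneg)
  have eq: "T ` T ` below f = T ` below f"
    by (auto simp: image_image below_def ET_idem cong: image_cong_simp)
  show "Tc (Tc f) = Tc f" by (rule Tc_eqI[OF inc]) (simp only: eq isLub_Tc[OF f])
  have "isUb UNIV (T ` T ` below f) (Tc f)" unfolding eq using isLub_Tc[OF f] by (rule isLub_isUb)
  with inc Tc_nonneg[OF f] show "Tc f \<in> C" unfolding natural_cone_def by blast
qed

section \<open>The extension of T to the whole natural domain\<close>

abbreviation "L \<equiv> L1 E T"
abbreviation "Tx \<equiv> T_ext E T"

text \<open>Two representations f - g = f1 - f2 give f + f2 = f1 + g, and additivity on the cone
  makes the values agree.\<close>

lemma T_ext_diff:
  assumes "f \<in> C" "g \<in> C" shows "f - g \<in> L" "Tx (f - g) = Tc f - Tc g"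
proof -
  show "f - g \<in> L" using assms by (auto simp: L1_def)
  show "Tx (f - g) = Tc f - Tc g"
    unfolding T_ext_def
  proof (rule the_equality)
    show "\<exists>f1\<in>C. \<exists>f2\<in>C. f - g = f1 - f2 \<and> Tc f - Tc g = Tc f1 - Tc f2" using assms by blast
    fix t assume "\<exists>f1\<in>C. \<exists>f2\<in>C. f - g = f1 - f2 \<and> t = Tc f1 - Tc f2"
    then obtain f1 f2 where *: "f1 \<in> C" "f2 \<in> C" "f - g = f1 - f2" "t = Tc f1 - Tc f2" by blast
    then have "f + f2 = f1 + g" by (simp add: algebra_simps)
    then have "Tc f + Tc f2 = Tc f1 + Tc g" using * assms by (metis Tc_add)
    then show "t = Tc f - Tc g" unfolding * by (simp add: algebra_simps)
  qed
qed

lemma L_decomp: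
  assumes "x \<in> L" obtains f g where "f \<in> C" "g \<in> C" "x = f - g"
  using assms by (auto simp: L1_def)

lemma C_L: "f \<in> C \<Longrightarrow> f \<in> L" and T_ext_C: "f \<in> C \<Longrightarrow> Tx f = Tc f"
  using T_ext_diff[OF _ C_zero, of f] by (simp_all add: Tc_zero)

lemma L_iff: "x \<in> L \<longleftrightarrow> \<bar>x\<bar> \<in> C"
proof
  assume "x \<in> L"
  then obtain f g where fg: "f \<in> C" "g \<in> C" "x = f - g" by (rule L_decomp)
  then have "\<bar>x\<bar> \<le> f + g" using abs_triangle_ineq4[of f g] by (simp add: C_nonneg)
  with fg show "\<bar>x\<bar> \<in> C" by (auto intro: C_down[OF C_add])
next
  assume *: "\<bar>x\<bar> \<in> C"
  have "pprt x \<in> C" "- nprt x \<in> C" by (auto intro!: C_down[OF *] simp: pprt_le_abs)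
  from T_ext_diff(1)[OF this] show "x \<in> L" by (simp add: pprt_minus_nprt)
qed

lemma L_nonneg: "x \<in> L \<Longrightarrow> 0 \<le> x \<Longrightarrow> x \<in> C"
  by (simp add: L_iff)

sublocale cond_exp_ideal e L Tx
proof
  show "e \<in> L" using unit_E by (simp add: C_L E_in_C)
  show "Tx e = e" using unit_E by (simp add: T_ext_C E_in_C Tc_E T_e)
  fix x y c
  show "y \<in> L" if "x \<in> L" "\<bar>y\<bar> \<le> \<bar>x\<bar>"
    using that by (auto simp: L_iff intro: C_down)
  show "x + y \<in> L" "Tx (x + y) = Tx x + Tx y" if xy: "x \<in> L" "y \<in> L"
  proof -
    obtain f g where fg: "f \<in> C" "g \<in> C" "x = f - g" using xy(1) by (rule L_decomp)
    obtain f' g' where fg': "f' \<in> C" "g' \<in> C" "y = f' - g'" using xy(2) by (rule L_decomp)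
    have eq: "x + y = (f + f') - (g + g')" unfolding fg fg' by simp
    show "x + y \<in> L" unfolding eq using fg fg' by (intro T_ext_diff C_add)
    show "Tx (x + y) = Tx x + Tx y"
      unfolding eq using fg fg' by (simp add: T_ext_diff[OF C_add C_add] T_ext_diff Tc_add)
  qed
  assume x: "x \<in> L"
  then obtain f g where fg: "f \<in> C" "g \<in> C" "x = f - g" by (rule L_decomp)
  show "c *\<^sub>R x \<in> L" "Tx (c *\<^sub>R x) = c *\<^sub>R Tx x"
  proof -
    have "c *\<^sub>R x \<in> L \<and> Tx (c *\<^sub>R x) = c *\<^sub>R Tx x"
    proof (cases "0 \<le> c")
      case True
      then show ?thesis
        using T_ext_diff[of "c *\<^sub>R f" "c *\<^sub>R g"] fg
        by (simp add: C_scaleR T_ext_diff Tc_scaleR scaleR_right_diff_distrib)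
    next
      case False
      then have "c *\<^sub>R x = (- c) *\<^sub>R g - (- c) *\<^sub>R f" unfolding fg by (simp add: algebra_simps)
      then show ?thesis
        using False T_ext_diff[of "(- c) *\<^sub>R g" "(- c) *\<^sub>R f"] C_scaleR[of _ "- c"] Tc_scaleR[of _ "- c"] fg
        by (simp add: T_ext_diff scaleR_right_diff_distrib)
    qed
    then show "c *\<^sub>R x \<in> L" "Tx (c *\<^sub>R x) = c *\<^sub>R Tx x" by auto
  qed
  have "Tx x = Tc f - Tc g" using fg by (simp add: T_ext_diff)
  then show "Tx x \<in> L" "Tx (Tx x) = Tx x" using fg by (simp_all add: T_ext_diff Tc_in_C)
  assume x0: "0 \<le> x"
  then have xC: "x \<in> C" using x by (rule L_nonneg[rotated])
  then show "0 \<le> Tx x" by (simp add: T_ext_C Tc_nonneg)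
  assume "Tx x = 0"
  then have Tc0: "Tc x = 0" using xC by (simp add: T_ext_C)
  show "x = 0"
  proof (rule ccontr)
    assume "x \<noteq> 0"
    with x0 have "0 < x" by (simp add: order_less_le)
    \<comment> \<open>Strict positivity is given on E only; order density supplies a nonzero element
      of E below x on which T would have to vanish.\<close>
    then obtain d where d: "d \<in> E" "0 < d" "d \<le> x" by (rule dense_E)
    then have "T d \<le> 0" using Tc_upper[OF xC, of d] Tc0 by (simp add: below_def)
    moreover have "0 \<le> T d" using d by (simp add: ET_nonneg)
    ultimately have "T d = 0" by simp
    with strict d show False unfolding strictly_positive_def by (metis order.strict_iff_not order.strict_implies_order)
  qed
next
  fix D f b
  assume D: "D \<subseteq> L" "\<And>d. d \<in> D \<Longrightarrow> 0 \<le> d" "up_directed D" "isLub UNIV D f"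
    and b: "\<And>d. d \<in> D \<Longrightarrow> Tx d \<le> b"
  \<comment> \<open>Members of D may lie outside E, but \<open>inf d d'\<close> lies in E because E
    is an ideal. This is why \<open>T_le_if_T_inf_le\<close> asks for bounds on these infima
    only.\<close>
  have "T d \<le> b" if d: "d \<in> below f" for d
  proof (rule T_le_if_T_inf_le[OF D(3,4,2) d])
    fix d' assume d': "d' \<in> D"
    then have d'C: "d' \<in> C" using D L_nonneg by blast
    have dE: "d \<in> E" "0 \<le> d" using d by (auto simp: below_def)
    have "inf d d' \<in> E" by (rule E_ideal[OF _ _ dE(1)]) (use D(2) d' dE in auto)
    then have "inf d d' \<in> below d'" using dE D(2)[OF d'] by (auto simp: below_def)
    then have "T (inf d d') \<le> Tc d'" by (rule Tc_upper[OF d'C])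
    also have "\<dots> \<le> b" using b[OF d'] d'C by (simp add: T_ext_C)
    finally show "T (inf d d') \<le> b" .
  qed
  moreover have "0 \<le> f"
    using D unfolding up_directed_def isLub_UNIV_iff by (meson ex_in_conv order.trans)
  ultimately have "f \<in> C" unfolding natural_cone_iff by blast
  moreover have "Tc f \<le> b" by (intro Tc_least) fact+
  ultimately show "f \<in> L \<and> Tx f \<le> b" by (simp add: C_L T_ext_C)
qed

section \<open>Identification of the concrete operator classes with the abstract ones\<close>

lemma L2_eq: "L2 E T = H"
  by (simp add: L2_def H_def)

lemma norm_T_eq: "norm_T E T x = nrm x"
  by (simp add: norm_T_def nrm_def rangeT_def inner_T_def)

lemma BT_pos_eq: "BT_pos E T = pos_bounded"
proof -
  have "(\<forall>x\<in>H. nrm (S x) \<le> k * nrm x) \<longleftrightarrow> (\<forall>x\<in>H. Tx (S x * S x) \<le> k * k * Tx (x * x))"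
    if "A_linear A H S" "0 \<le> k" for S k
    using that nrm_le_iff A_linearD(2)[OF that(1)] by auto
  then show ?thesis
    unfolding BT_pos_def BT_def pos_bounded_def L2_eq norm_T_eq rangeT_def by blast
qed

lemma BT_reg_eq: "BT_reg E T = regular"
  by (simp add: BT_reg_def regular_def BT_pos_eq)

end

theorem proposition9p10:
  fixes E :: "'u::{ordered_real_vector, real_algebra, lattice_ring} set"
    and T :: "'u \<Rightarrow> 'u" and e :: 'u
  assumes "is_universal_completion E"
    and "dedekind_complete E"
    and "weak_order_unit E e"
    and "f_algebra_with_unit e"
    and "conditional_expectation E T"
    and "T e = e"
    and "strictly_positive E T"
  shows "{S \<in> BT_reg E T. op_le (L2 E T) (\<lambda>x. 0) S} = BT_pos E T \<and>
     order_ideal_Lb (rangeT E T) (L2 E T) (BT_reg E T) \<and>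
     (\<forall>R \<in> Lb (rangeT E T) (L2 E T). \<forall>S \<in> BT_reg E T.
        op_le (L2 E T) (rk_modulus (L2 E T) R) (rk_modulus (L2 E T) S) \<longrightarrow> R \<in> BT_reg E T)"
proof -
  interpret riesz_cond_exp e E T
    using assms by unfold_locales (auto simp: is_universal_completion_def weak_order_unit_def)
  show ?thesis
    unfolding BT_reg_eq BT_pos_eq L2_eq rangeT_def
    using regular_positive order_ideal_regular regular_if_rk_modulus_le by blast
qed

end
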